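(* For minimum slack $\beta = (1+\varepsilon)s_B$ with $1/s_B \le \varepsilon \le 1$, the online algorithm BatchedDispatch($\varepsilon$) is $O(c/\varepsilon + 1/\varepsilon^3)$-competitive for CloudScheduling.
   Context: CloudScheduling: there are two machine types $\tau \in \{A,B\}$ with setup times $s_A, s_B > 0$ and cost rates $c_A, c_B$; normalize $s_B \ge s_A$, $c_A = 1$, $c := c_B \ge 1$. A machine $M$ of type $\tau$ may be opened at any time $a_M \ge 0$ and closed at any time $b_M \ge a_M + s_\tau$; it can process jobs only during $[a_M+s_\tau, b_M]$, and it costs $c_\tau (b_M - a_M)$. A job $j$ has release time $r_j \ge 0$, deadline $d_j > 0$ and sizes $p_{j,A}, p_{j,B} \ge 1$; jobs arrive online at their release times, when deadline and sizes become known. Each job must be processed, without interruption, on exactly one machine $M$ of some type $\tau$ during an interval of length $p_{j,\tau}$ contained in $[r_j,d_j]\cap[a_M+s_\tau,b_M]$; a machine processes at most one job at a time. Objective: minimize total rental cost; $\mathrm{Opt}$ is the optimal offline cost. Slack $\sigma_{j,\tau} = d_j-r_j-p_{j,\tau}$; an instance has minimum slack $\beta$ if $\max_\tau\sigma_{j,\tau}\ge\beta$ for all $j$. An algorithm is $\rho$-competitive for $\beta$ if on every instance with minimum slack $\beta$ it produces a feasible schedule of cost at most $\rho\cdot\mathrm{Opt}$. Standing assumption: only instances with $\mathrm{Opt}=\Omega(c\cdot r_{\max})$, $r_{\max}=\max_j r_j$, are considered. Let $\Delta = \tfrac12\varepsilon s_B$ and let $C$ be the condition ($s_B \ge s_A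 + \Delta$ and $s_A/c > \Delta$). A tentative schedule for a set of jobs is a schedule in the relaxed model in which setups take no time but still cost $c_\tau s_\tau$ per machine of type $\tau$ (so a machine processing during $[a,b]$ costs $c_\tau(s_\tau + b - a)$), each job starts no earlier than its release time and finishes by its (modified) deadline; tentative schedules are computed to have minimum cost subject to the stated restrictions. Algorithm BatchedDispatch($\varepsilon$): in phase $i\in\mathbb{N}$ it handles the jobs with $r_j\in[(i-1)\Delta,i\Delta)$. (1) Upon arrival of job $j$ at time $t$: set $d_j := d_j - s_B$ (all slacks below are w.r.t. this modified deadline); classify $j$ into $J_1 = \{j : \sigma_{j,B}\ge 2\Delta \wedge (\sigma_{j,A}\ge2\Delta \vee p_{j,A}\le\Delta)\}$, $J_2 = \{j : \sigma_{j,B}\ge2\Delta \wedge \sigma_{j,A}<2\Delta \wedge p_{j,A}>\Delta\}$, or $J_3 = \{j: \sigma_{j,B}<2\Delta \wedge \sigma_{j,A}\ge 2\Delta\}$; if $C$ holds put $J_{2,1}:=J_2$, $J_{2,2}:=\emptyset$, otherwise $J_{2,1}:=\{j\in J_2 : c\,p_{j,B} > s_A\}$, $J_{2,2}:=J_2\setminus J_{2,1}$; if $C$ does not hold and $j\in J_{2,1}$, open a machine of type $A$ at time $t$. (2) At time $i\Delta$: compute, separately for the phase's jobs in each of $J_1, J_{2,1}, J_{2,2}, J_3$, a tentative schedule with the extra restrictions that jobs of $J_1$, $J_{2,2}$, $J_3$ start at or after $i\Delta$, jobs of $J_{2,1}$ placed on type-$B$ machines start at or after $i\Delta$, jobs of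 $J_{2,2}$ use only type-$B$ machines and jobs of $J_3$ use only type-$A$ machines. Then realize these schedules by increasing the starting times of jobs of $J_1$ by $s_\tau$ on machines of type $\tau$; of $J_{2,1}$ by $s_B$ on type-$B$ machines and on type-$A$ machines by $s_A+\Delta$ if $C$ holds and by $s_A$ otherwise; of $J_{2,2}$ by $s_B$; of $J_3$ by $s_A$; the corresponding setups are started at time $i\Delta$, except that the type-$A$ machines opened in step (1) are used for $J_{2,1}$ where necessary, and otherwise closed once their setup finishes.
   Formalization: Among minimum-cost tentative schedules, only those in which every machine begins processing no later than iΔ are chosen; with arbitrary ties, a machine set up at iΔ could idle until a far deadline at unbounded cost, and the claim would fail. *)

theory Defs
  imports Complex_Main
begin

section \<open>The problem CloudScheduling\<close>

datatype mtype = TypeA | TypeB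

record cloud =
  setup_time :: "mtype \<Rightarrow> real"
  rate :: "mtype \<Rightarrow> real"

definition normalized_cloud :: "cloud \<Rightarrow> bool" where
  "normalized_cloud Q \<longleftrightarrow>
     0 < setup_time Q TypeA \<and> setup_time Q TypeA \<le> setup_time Q TypeB \<and>
     rate Q TypeA = 1 \<and> 1 \<le> rate Q TypeB"

text \<open>Jobs are named by natural numbers; the values of the functions outside \<open>jobs\<close> are irrelevant.\<close>

record inst =
  jobs :: "nat set"
  release :: "nat \<Rightarrow> real"
  deadline :: "nat \<Rightarrow> real"
  psize :: "nat \<Rightarrow> mtype \<Rightarrow> real"

definition valid_inst :: "inst \<Rightarrow> bool" where
  "valid_inst I \<longleftrightarrow> finite (jobs I) \<and>
     (\<forall>j\<in>jobs I. 0 \<le> release I j \<and> 0 < deadline I j \<and> (\<forall>\<tau>. 1 \<le> psize I j \<tau>))"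

definition slack :: "inst \<Rightarrow> nat \<Rightarrow> mtype \<Rightarrow> real" where
  "slack I j \<tau> = deadline I j - release I j - psize I j \<tau>"

definition min_slack :: "real \<Rightarrow> inst \<Rightarrow> bool" where
  "min_slack \<beta> I \<longleftrightarrow> (\<forall>j\<in>jobs I. \<beta> \<le> max (slack I j TypeA) (slack I j TypeB))"

text \<open>Release times are nonnegative, so the inserted \<open>0\<close> matters only for the empty instance.\<close>

definition r_max :: "inst \<Rightarrow> real" where
  "r_max I = Max (insert 0 (release I ` jobs I))"

record 'm schedule =
  machines :: "'m set"
  mach_type :: "'m \<Rightarrow> mtype"
  open_at :: "'m \<Rightarrow> real"
  close_at :: "'m \<Rightarrow> real"
  assigned :: "nat \<Rightarrow> 'm"
  start :: "nat \<Rightarrow> real"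

definition finish :: "inst \<Rightarrow> 'm schedule \<Rightarrow> nat \<Rightarrow> real" where
  "finish I S j = start S j + psize I j (mach_type S (assigned S j))"

definition feasible :: "cloud \<Rightarrow> inst \<Rightarrow> 'm schedule \<Rightarrow> bool" where
  "feasible Q I S \<longleftrightarrow>
     finite (machines S) \<and>
     (\<forall>M\<in>machines S. 0 \<le> open_at S M \<and> open_at S M + setup_time Q (mach_type S M) \<le> close_at S M) \<and>
     (\<forall>j\<in>jobs I. assigned S j \<in> machines S \<and>
        release I j \<le> start S j \<and> finish I S j \<le> deadline I j \<and>
        open_at S (assigned S j) + setup_time Q (mach_type S (assigned S j)) \<le> start S j \<and>
        finish I S j \<le> close_at S (assigned S j)) \<and>
     (\<forall>j\<in>jobs I. \<forall>k\<in>jobs I. j \<noteq> k \<and> assigned S j = assigned S k \<longrightarrow>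
        finish I S j \<le> start S k \<or> finish I S k \<le> start S j)"

definition cost :: "cloud \<Rightarrow> 'm schedule \<Rightarrow> real" where
  "cost Q S = (\<Sum>M\<in>machines S. rate Q (mach_type S M) * (close_at S M - open_at S M))"

definition Opt :: "cloud \<Rightarrow> inst \<Rightarrow> real" where
  "Opt Q I = Inf {cost Q S | S :: nat schedule. feasible Q I S}"

text \<open>An algorithm whose description leaves some choices open (ties between minimum cost
  schedules, say) is the relation between instances and possible outputs. It has to produce
  some output, and every possible output has to be good. The number \<open>\<kappa>\<close> is the
  constant hidden in the standing assumption that \<open>Opt\<close> is in \<open>\<Omega>(c r_max)\<close>.\<close>

definition competitive ::
  "cloud \<Rightarrow> real \<Rightarrow> (inst \<Rightarrow> 'm schedule \<Rightarrow> bool) \<Rightarrow> real \<Rightarrow> real \<Rightarrow> bool" where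
  "competitive Q \<kappa> Alg \<beta> \<rho> \<longleftrightarrow>
     (\<forall>I. valid_inst I \<and> min_slack \<beta> I \<and> \<kappa> * (rate Q TypeB * r_max I) \<le> Opt Q I \<longrightarrow>
        (\<exists>S. Alg I S) \<and>
        (\<forall>S. Alg I S \<longrightarrow> feasible Q I S \<and> cost Q S \<le> \<rho> * Opt Q I))"


section \<open>The algorithm BatchedDispatch\<close>

definition Delta :: "cloud \<Rightarrow> real \<Rightarrow> real" where
  "Delta Q \<epsilon> = 1 / 2 * \<epsilon> * setup_time Q TypeB"

definition condC :: "cloud \<Rightarrow> real \<Rightarrow> bool" where
  "condC Q \<epsilon> \<longleftrightarrow>
     setup_time Q TypeB \<ge> setup_time Q TypeA + Delta Q \<epsilon> \<and>
     setup_time Q TypeA / rate Q TypeB > Delta Q \<epsilon>"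

text \<open>In the definitions from here up to \<open>realizes\<close>, the instance is meant to be the one
  with the modified deadlines; \<open>batched_dispatch\<close> passes \<open>tighten Q I\<close> to them.\<close>

definition tighten :: "cloud \<Rightarrow> inst \<Rightarrow> inst" where
  "tighten Q I = I\<lparr>deadline := \<lambda>j. deadline I j - setup_time Q TypeB\<rparr>"

datatype jclass = J1 | J21 | J22 | J3

definition J2_jobs :: "cloud \<Rightarrow> real \<Rightarrow> inst \<Rightarrow> nat set" where
  "J2_jobs Q \<epsilon> I = {j\<in>jobs I. slack I j TypeB \<ge> 2 * Delta Q \<epsilon> \<and>
     slack I j TypeA < 2 * Delta Q \<epsilon> \<and> psize I j TypeA > Delta Q \<epsilon>}"

definition J21_jobs :: "cloud \<Rightarrow> real \<Rightarrow> inst \<Rightarrow> nat set" where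
  "J21_jobs Q \<epsilon> I =
     (if condC Q \<epsilon> then J2_jobs Q \<epsilon> I
      else {j\<in>J2_jobs Q \<epsilon> I. rate Q TypeB * psize I j TypeB > setup_time Q TypeA})"

fun class_jobs :: "cloud \<Rightarrow> real \<Rightarrow> inst \<Rightarrow> jclass \<Rightarrow> nat set" where
  "class_jobs Q \<epsilon> I J1 = {j\<in>jobs I. slack I j TypeB \<ge> 2 * Delta Q \<epsilon> \<and>
     (slack I j TypeA \<ge> 2 * Delta Q \<epsilon> \<or> psize I j TypeA \<le> Delta Q \<epsilon>)}"
| "class_jobs Q \<epsilon> I J21 = J21_jobs Q \<epsilon> I"
| "class_jobs Q \<epsilon> I J22 = J2_jobs Q \<epsilon> I - J21_jobs Q \<epsilon> I"
| "class_jobs Q \<epsilon> I J3 = {j\<in>jobs I. slack I j TypeB < 2 * Delta Q \<epsilon> \<and>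
     slack I j TypeA \<ge> 2 * Delta Q \<epsilon>}"

text \<open>Phases are numbered from 1.\<close>

definition phase_end :: "cloud \<Rightarrow> real \<Rightarrow> nat \<Rightarrow> real" where
  "phase_end Q \<epsilon> i = real i * Delta Q \<epsilon>"

definition batch :: "cloud \<Rightarrow> real \<Rightarrow> inst \<Rightarrow> nat \<Rightarrow> jclass \<Rightarrow> nat set" where
  "batch Q \<epsilon> I i k = {j\<in>class_jobs Q \<epsilon> I k.
     phase_end Q \<epsilon> (i - 1) \<le> release I j \<and> release I j < phase_end Q \<epsilon> i}"

subsection \<open>Tentative schedules\<close>

text \<open>A tentative schedule for a set \<open>X\<close> of jobs consists of the machines that get a job of \<open>X\<close>;
  such a machine is in operation from its first start to its last completion.\<close>

record tent =
  t_assign :: "nat \<Rightarrow> nat"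
  t_type :: "nat \<Rightarrow> mtype"
  t_start :: "nat \<Rightarrow> real"

definition t_machines :: "nat set \<Rightarrow> tent \<Rightarrow> nat set" where
  "t_machines X T = t_assign T ` X"

definition t_finish :: "inst \<Rightarrow> tent \<Rightarrow> nat \<Rightarrow> real" where
  "t_finish I T j = t_start T j + psize I j (t_type T (t_assign T j))"

definition t_from :: "nat set \<Rightarrow> tent \<Rightarrow> nat \<Rightarrow> real" where
  "t_from X T m = Min (t_start T ` {j\<in>X. t_assign T j = m})"

definition t_to :: "inst \<Rightarrow> nat set \<Rightarrow> tent \<Rightarrow> nat \<Rightarrow> real" where
  "t_to I X T m = Max (t_finish I T ` {j\<in>X. t_assign T j = m})"

definition t_cost :: "cloud \<Rightarrow> inst \<Rightarrow> nat set \<Rightarrow> tent \<Rightarrow> real" where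
  "t_cost Q I X T = (\<Sum>m\<in>t_machines X T.
     rate Q (t_type T m) * (setup_time Q (t_type T m) + t_to I X T m - t_from X T m))"

definition t_feasible :: "inst \<Rightarrow> nat set \<Rightarrow> tent \<Rightarrow> bool" where
  "t_feasible I X T \<longleftrightarrow>
     (\<forall>j\<in>X. release I j \<le> t_start T j \<and> t_finish I T j \<le> deadline I j) \<and>
     (\<forall>j\<in>X. \<forall>k\<in>X. j \<noteq> k \<and> t_assign T j = t_assign T k \<longrightarrow>
        t_finish I T j \<le> t_start T k \<or> t_finish I T k \<le> t_start T j)"

fun allowed_types :: "jclass \<Rightarrow> mtype set" where
  "allowed_types J1 = {TypeA, TypeB}"
| "allowed_types J21 = {TypeA, TypeB}"
| "allowed_types J22 = {TypeB}"
| "allowed_types J3 = {TypeA}"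

definition t_admissible :: "cloud \<Rightarrow> real \<Rightarrow> inst \<Rightarrow> nat \<Rightarrow> jclass \<Rightarrow> tent \<Rightarrow> bool" where
  "t_admissible Q \<epsilon> I i k T \<longleftrightarrow>
     t_feasible I (batch Q \<epsilon> I i k) T \<and>
     (\<forall>j\<in>batch Q \<epsilon> I i k.
        t_type T (t_assign T j) \<in> allowed_types k \<and>
        (\<not> (k = J21 \<and> t_type T (t_assign T j) = TypeA) \<longrightarrow> phase_end Q \<epsilon> i \<le> t_start T j))"

text \<open>The minimum is taken over all admissible schedules. All jobs of a phase are released
  before its end, so a machine beginning later than that can be moved forward in time without
  changing the cost. The last condition selects among the minimum cost schedules those in which
  this has been done: all setups are started at the end of the phase, so a machine that is
  used only much later would stand idle, at unbounded cost.\<close>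

definition tentative :: "cloud \<Rightarrow> real \<Rightarrow> inst \<Rightarrow> nat \<Rightarrow> jclass \<Rightarrow> tent \<Rightarrow> bool" where
  "tentative Q \<epsilon> I i k T \<longleftrightarrow>
     t_admissible Q \<epsilon> I i k T \<and>
     (\<forall>T'. t_admissible Q \<epsilon> I i k T' \<longrightarrow>
        t_cost Q I (batch Q \<epsilon> I i k) T \<le> t_cost Q I (batch Q \<epsilon> I i k) T') \<and>
     (\<forall>m\<in>t_machines (batch Q \<epsilon> I i k) T. t_from (batch Q \<epsilon> I i k) T m \<le> phase_end Q \<epsilon> i)"

subsection \<open>Realization\<close>

definition delay :: "cloud \<Rightarrow> real \<Rightarrow> jclass \<Rightarrow> mtype \<Rightarrow> real" where
  "delay Q \<epsilon> k \<tau> =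
     (if k = J21 \<and> \<tau> = TypeA \<and> condC Q \<epsilon> then setup_time Q TypeA + Delta Q \<epsilon> else setup_time Q \<tau>)"

text \<open>\<open>Batch i k m\<close> realizes machine \<open>m\<close> of the tentative schedule for class \<open>k\<close> in phase \<open>i\<close>
  and is opened at the end of the phase; \<open>Early j\<close> is the type-A machine opened upon the arrival
  of job \<open>j\<close>.\<close>

datatype mach_id = Batch nat jclass nat | Early nat

text \<open>If \<open>condC\<close> fails, the jobs of class \<open>J21\<close> on type-A machines are delayed only by
  \<open>setup_time Q TypeA\<close>. A machine opened at the end of the phase is then too late for a tentative
  machine that begins before the end of the phase, and an early machine is necessary.\<close>

definition needs_early :: "cloud \<Rightarrow> real \<Rightarrow> inst \<Rightarrow> nat \<Rightarrow> jclass \<Rightarrow> tent \<Rightarrow> nat \<Rightarrow> bool" where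
  "needs_early Q \<epsilon> I i k T m \<longleftrightarrow>
     \<not> condC Q \<epsilon> \<and> k = J21 \<and> t_type T m = TypeA \<and>
     t_from (batch Q \<epsilon> I i k) T m < phase_end Q \<epsilon> i"

text \<open>The early machines are distributed arbitrarily, but each to at most one tentative machine
  and only to one that does not begin before the early machine was opened.\<close>

definition early_choice :: "cloud \<Rightarrow> real \<Rightarrow> inst \<Rightarrow> nat \<Rightarrow> tent \<Rightarrow> (nat \<Rightarrow> nat) \<Rightarrow> bool" where
  "early_choice Q \<epsilon> I i T g \<longleftrightarrow>
     (let X = batch Q \<epsilon> I i J21; N = {m\<in>t_machines X T. needs_early Q \<epsilon> I i J21 T m}
      in inj_on g N \<and> (\<forall>m\<in>N. g m \<in> X \<and> release I (g m) \<le> t_from X T m))"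

definition host ::
  "cloud \<Rightarrow> real \<Rightarrow> inst \<Rightarrow> (nat \<Rightarrow> jclass \<Rightarrow> tent) \<Rightarrow> (nat \<Rightarrow> nat \<Rightarrow> nat) \<Rightarrow>
   nat \<Rightarrow> jclass \<Rightarrow> nat \<Rightarrow> mach_id" where
  "host Q \<epsilon> I T g i k m =
     (if needs_early Q \<epsilon> I i k (T i k) m then Early (g i m) else Batch i k m)"

definition used_machines ::
  "cloud \<Rightarrow> real \<Rightarrow> inst \<Rightarrow> (nat \<Rightarrow> jclass \<Rightarrow> tent) \<Rightarrow> (nat \<Rightarrow> nat \<Rightarrow> nat) \<Rightarrow> mach_id set" where
  "used_machines Q \<epsilon> I T g =
     {host Q \<epsilon> I T g i k m | i k m. 1 \<le> i \<and> m \<in> t_machines (batch Q \<epsilon> I i k) (T i k)}"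

definition early_machines :: "cloud \<Rightarrow> real \<Rightarrow> inst \<Rightarrow> mach_id set" where
  "early_machines Q \<epsilon> I = (if condC Q \<epsilon> then {} else Early ` J21_jobs Q \<epsilon> I)"

fun opening_time :: "cloud \<Rightarrow> real \<Rightarrow> inst \<Rightarrow> mach_id \<Rightarrow> real" where
  "opening_time Q \<epsilon> I (Batch i k m) = phase_end Q \<epsilon> i"
| "opening_time Q \<epsilon> I (Early j) = release I j"

definition realizes ::
  "cloud \<Rightarrow> real \<Rightarrow> inst \<Rightarrow> (nat \<Rightarrow> jclass \<Rightarrow> tent) \<Rightarrow> (nat \<Rightarrow> nat \<Rightarrow> nat) \<Rightarrow>
   mach_id schedule \<Rightarrow> bool" where
  "realizes Q \<epsilon> I T g S \<longleftrightarrow>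
     machines S = used_machines Q \<epsilon> I T g \<union> early_machines Q \<epsilon> I \<and>
     (\<forall>M\<in>machines S. open_at S M = opening_time Q \<epsilon> I M) \<and>
     (\<forall>M\<in>early_machines Q \<epsilon> I. mach_type S M = TypeA \<and>
        (M \<notin> used_machines Q \<epsilon> I T g \<longrightarrow> close_at S M = open_at S M + setup_time Q TypeA)) \<and>
     (\<forall>i\<ge>1. \<forall>k. \<forall>m\<in>t_machines (batch Q \<epsilon> I i k) (T i k).
        mach_type S (host Q \<epsilon> I T g i k m) = t_type (T i k) m \<and>
        close_at S (host Q \<epsilon> I T g i k m) =
          t_to I (batch Q \<epsilon> I i k) (T i k) m + delay Q \<epsilon> k (t_type (T i k) m)) \<and>
     (\<forall>i\<ge>1. \<forall>k. \<forall>j\<in>batch Q \<epsilon> I i k.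
        assigned S j = host Q \<epsilon> I T g i k (t_assign (T i k) j) \<and>
        start S j = t_start (T i k) j + delay Q \<epsilon> k (t_type (T i k) (t_assign (T i k) j)))"

definition batched_dispatch :: "cloud \<Rightarrow> real \<Rightarrow> inst \<Rightarrow> mach_id schedule \<Rightarrow> bool" where
  "batched_dispatch Q \<epsilon> I S \<longleftrightarrow>
     (\<exists>T g. (\<forall>i\<ge>1. \<forall>k. tentative Q \<epsilon> (tighten Q I) i k (T i k)) \<and>
        (\<forall>i\<ge>1. early_choice Q \<epsilon> (tighten Q I) i (T i J21) (g i)) \<and>
        realizes Q \<epsilon> (tighten Q I) T g S)"

end

theory Submission
  imports Defs "HOL-Analysis.Function_Topology"
begin

text \<open>
  Let \<open>R\<close> be an arbitrary feasible schedule. The cost of \<open>R\<close> is at least the total length of its jobs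
  weighted with the rates, and it is at least the setup cost of each of its machines. A batch of jobs
  with slack at least \<open>2 * \<Delta>\<close> on a machine type can be packed greedily into machines of this type that
  start jobs only in the \<open>\<Delta>\<close> time units after the end of the phase. All but one of these machines
  work for about \<open>\<Delta>\<close>, so their setups cost \<open>2 / \<epsilon>\<close> times the work, up to the \<open>c\<close> by which the rates
  differ. A job on the other machine type than in \<open>R\<close> gets shorter, as its slack grows. The one
  poorly filled machine per batch is paid by the standing assumption, because there are at most
  \<open>r_max / \<Delta> + 1\<close> phases, and the additive \<open>1\<close> is paid by \<open>R\<close> itself: either \<open>R\<close> costs at least
  \<open>\<Delta> = \<epsilon> s\<^sub>B / 2\<close> or uses a machine of type B, or it is so small that type A suffices. Realizing a
  tentative schedule at most doubles its cost, and an unused early machine costs at most \<open>2 / \<epsilon>\<close>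
  times what \<open>R\<close> pays for processing its job. Hence already \<open>O(c / \<epsilon>)\<close> is a bound.
\<close>


text \<open>Induction in the order of the starts. As lengths are positive, all other jobs end before
  the job \<open>x\<close> that starts last begins, so the induction hypothesis applies with
  \<open>st x\<close> in place of \<open>b\<close>.\<close>

lemma sum_lengths_le:
  fixes st p :: "nat \<Rightarrow> real"
  assumes "finite X" "a \<le> b"
    and "\<And>j. j \<in> X \<Longrightarrow> 0 < p j" "\<And>j. j \<in> X \<Longrightarrow> a \<le> st j" "\<And>j. j \<in> X \<Longrightarrow> st j + p j \<le> b"
    and "\<And>j k. j \<in> X \<Longrightarrow> k \<in> X \<Longrightarrow> j \<noteq> k \<Longrightarrow> st j + p j \<le> st k \<or> st k + p k \<le> st j"
  shows "sum p X \<le> b - a"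
  using assms
proof (induction X arbitrary: b rule: finite_ranking_induct[where f = st])
  case (insert x S)
  show ?case
  \<comment> \<open>The ranking induction does not guarantee that the inserted element is
    new.\<close>
  proof (cases "x \<in> S")
    case True
    then show ?thesis
      using insert.IH insert.prems by (simp add: insert_absorb)
  next
    case False
    have "sum p S \<le> st x - a"
    proof (rule insert.IH)
      fix j assume j: "j \<in> S"
      then have "st j + p j \<le> st x \<or> st x + p x \<le> st j"
        using False insert.prems(5)[of j x] by auto
      moreover have "0 < p x" "st j \<le> st x"
        using insert.prems(2) insert.hyps(2) j by auto
      ultimately show "st j + p j \<le> st x"
        by linarith
    qed (use insert.prems in auto)
    moreover have "st x + p x \<le> b"
      using insert.prems by auto
    ultimately show ?thesis
      using False insert.hyps by simp
  qed
qed auto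

lemma UNIV_mtype: "UNIV = {TypeA, TypeB}"
  by (auto intro: mtype.exhaust)

lemma UNIV_jclass: "UNIV = {J1, J21, J22, J3}"
  by (auto intro: jclass.exhaust)

instance mtype :: finite
  by standard (simp add: UNIV_mtype)

instance jclass :: finite
  by standard (simp add: UNIV_jclass)


section \<open>Spans of tentative machines\<close>

lemma t_from_le: "finite X \<Longrightarrow> j \<in> X \<Longrightarrow> t_assign T j = m \<Longrightarrow> t_from X T m \<le> t_start T j"
  by (auto simp: t_from_def intro: Min_le)

lemma t_to_ge: "finite X \<Longrightarrow> j \<in> X \<Longrightarrow> t_assign T j = m \<Longrightarrow> t_finish I T j \<le> t_to I X T m"
  by (auto simp: t_to_def intro: Max_ge)

lemma t_from_attained:
  assumes "finite X" "m \<in> t_machines X T"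
  obtains j where "j \<in> X" "t_assign T j = m" "t_start T j = t_from X T m"
proof -
  have "t_from X T m \<in> t_start T ` {j\<in>X. t_assign T j = m}"
    unfolding t_from_def using assms by (intro Min_in) (auto simp: t_machines_def)
  then show ?thesis
    using that by auto
qed

lemma t_to_attained:
  assumes "finite X" "m \<in> t_machines X T"
  obtains j where "j \<in> X" "t_assign T j = m" "t_finish I T j = t_to I X T m"
proof -
  have "t_to I X T m \<in> t_finish I T ` {j\<in>X. t_assign T j = m}"
    unfolding t_to_def using assms by (intro Max_in) (auto simp: t_machines_def)
  then show ?thesis
    using that by auto
qed

lemma psize_le_span:
  assumes "finite X" "j \<in> X" "t_assign T j = m"
  shows "psize I j (t_type T m) \<le> t_to I X T m - t_from X T m"
  using t_from_le[OF assms] t_to_ge[OF assms, of I] assms by (simp add: t_finish_def)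


section \<open>Existence of optimal tentative schedules\<close>

lemma continuous_on_Max_image:
  fixes f :: "'a \<Rightarrow> 'b::topological_space \<Rightarrow> 'c::linorder_topology"
  assumes "finite A" "A \<noteq> {}" "\<And>a. a \<in> A \<Longrightarrow> continuous_on S (f a)"
  shows "continuous_on S (\<lambda>x. Max ((\<lambda>a. f a x) ` A))"
  using assms by (induction A rule: finite_ne_induct) (auto intro!: continuous_on_max)

lemma continuous_on_Min_image:
  fixes f :: "'a \<Rightarrow> 'b::topological_space \<Rightarrow> 'c::linorder_topology"
  assumes "finite A" "A \<noteq> {}" "\<And>a. a \<in> A \<Longrightarrow> continuous_on S (f a)"
  shows "continuous_on S (\<lambda>x. Min ((\<lambda>a. f a x) ` A))"
  using assms by (induction A rule: finite_ne_induct) (auto intro!: continuous_on_min)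

text \<open>Tychonoff's theorem: starts are functions on all of \<open>nat\<close>, and the product
  topology on them serves every batch.\<close>

lemma compact_box:
  fixes lo hi :: "'a \<Rightarrow> real"
  shows "compact {s. \<forall>j. s j \<in> {lo j..hi j}}"
proof -
  have "compactin (product_topology (\<lambda>_. euclidean) UNIV) (PiE UNIV (\<lambda>j. {lo j..hi j}))"
    by (subst compactin_PiE) auto
  moreover have "PiE UNIV (\<lambda>j. {lo j..hi j}) = {s. \<forall>j. s j \<in> {lo j..hi j}}"
    by (auto simp: PiE_def extensional_def Pi_def)
  ultimately show ?thesis
    by (simp add: euclidean_product_topology)
qed

text \<open>The cost sees only the types and the spans of the machines. This covers renaming
  machines as well as moving each of them in time.\<close>

lemma t_cost_congs:
  assumes "inj_on h (t_machines X T)"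
    and "\<And>j. j \<in> X \<Longrightarrow> t_assign T' j = h (t_assign T j)"
    and "\<And>m. m \<in> t_machines X T \<Longrightarrow> t_type T' (h m) = t_type T m"
    and "\<And>m. m \<in> t_machines X T \<Longrightarrow>
      t_to I X T' (h m) - t_from X T' (h m) = t_to I X T m - t_from X T m"
  shows "t_cost Q I X T' = t_cost Q I X T"
proof -
  have "t_machines X T' = h ` t_machines X T"
    using assms(2) by (auto simp: t_machines_def image_image)
  then have "t_cost Q I X T' = (\<Sum>m\<in>t_machines X T. rate Q (t_type T' (h m)) *
      (setup_time Q (t_type T' (h m)) + t_to I X T' (h m) - t_from X T' (h m)))"
    using assms(1) by (simp add: t_cost_def sum.reindex)
  also have "\<dots> = t_cost Q I X T"
    unfolding t_cost_def
  proof (rule sum.cong[OF refl])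
    fix m assume m: "m \<in> t_machines X T"
    show "rate Q (t_type T' (h m)) * (setup_time Q (t_type T' (h m)) + t_to I X T' (h m) - t_from X T' (h m))
        = rate Q (t_type T m) * (setup_time Q (t_type T m) + t_to I X T m - t_from X T m)"
      using assms(3,4)[OF m] by simp
  qed
  finally show ?thesis .
qed

text \<open>Machine names are arbitrary numbers, so a batch has infinitely many assignments;
  renaming reduces them to finitely many.\<close>

lemma t_rename:
  assumes "inj_on h (t_machines X T)"
    and "\<And>j. j \<in> X \<Longrightarrow> t_assign T' j = h (t_assign T j)"
    and "\<And>j. j \<in> X \<Longrightarrow> t_start T' j = t_start T j"
    and "\<And>m. m \<in> t_machines X T \<Longrightarrow> t_type T' (h m) = t_type T m"
  shows "t_cost Q I X T' = t_cost Q I X T" "t_feasible I X T' = t_feasible I X T"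
proof -
  have inj: "h (t_assign T j) = h (t_assign T k) \<longleftrightarrow> t_assign T j = t_assign T k" if "j \<in> X" "k \<in> X" for j k
    using assms(1) that by (auto simp: t_machines_def inj_on_def)
  have fin: "t_finish I T' j = t_finish I T j" if "j \<in> X" for j
    using that assms(2-4) by (simp add: t_finish_def t_machines_def)
  have same: "{j\<in>X. t_assign T' j = h m} = {j\<in>X. t_assign T j = m}" if "m \<in> t_machines X T" for m
    using that assms(2) inj by (auto simp: t_machines_def)
  show "t_cost Q I X T' = t_cost Q I X T"
    using assms fin
    by (intro t_cost_congs[where h = h])
      (auto simp: t_to_def t_from_def same intro!: arg_cong2[where f = minus] arg_cong[where f = Max]
        arg_cong[where f = Min] image_cong)
  show "t_feasible I X T' = t_feasible I X T"
    using assms(2,3) fin inj unfolding t_feasible_def by auto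
qed

lemma closed_less_eq_coordinate: "closed {s. s j + (p::real) \<le> s k}" for j k :: 'a
  by (intro closed_Collect_le continuous_intros continuous_on_product_coordinates)

text \<open>Start times are real, so the minimum needs compactness. After renaming machines to jobs,
  finitely many choices of assignment and types remain; each admits a compact set of starts, on
  which the cost is continuous. Hence the set \<open>C\<close> of normalized costs is compact and
  contains its infimum.\<close>

lemma min_cost_exists:
  fixes Q \<epsilon> I i k
  defines "X \<equiv> batch Q \<epsilon> I i k"
  assumes X: "finite X" and adm: "t_admissible Q \<epsilon> I i k T0"
  obtains T where "t_admissible Q \<epsilon> I i k T"
    "\<And>T'. t_admissible Q \<epsilon> I i k T' \<Longrightarrow> t_cost Q I X T \<le> t_cost Q I X T'"
proof -
  \<comment> \<open>Machines are named after jobs of \<open>X\<close>, so both functions matter only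
    on \<open>X\<close>; the default values \<open>0\<close> and \<open>TypeA\<close> elsewhere make
    \<open>F\<close> finite.\<close>
  define F where "F = {a :: nat \<Rightarrow> nat. \<forall>j. (j \<in> X \<longrightarrow> a j \<in> X) \<and> (j \<notin> X \<longrightarrow> a j = 0)} \<times>
    {y :: nat \<Rightarrow> mtype. \<forall>j. (j \<in> X \<longrightarrow> y j \<in> UNIV) \<and> (j \<notin> X \<longrightarrow> y j = TypeA)}"
  define sched where "sched = (\<lambda>(a, y) s. \<lparr>t_assign = a, t_type = y, t_start = s\<rparr>)"
  define K where "K = (\<lambda>f. {s. (\<forall>j. j \<notin> X \<longrightarrow> s j = 0) \<and> t_admissible Q \<epsilon> I i k (sched f s)})"
  define C where "C = (\<Union>f\<in>F. (\<lambda>s. t_cost Q I X (sched f s)) ` K f)"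
  have "finite F"
    unfolding F_def using X by (intro finite_cartesian_product finite_set_of_finite_funs) auto
  have "compact (K f)" for f
  proof -
    obtain a y where f: "f = (a, y)"
      by (cases f)
    define lo where "lo j = (if j \<in> X then release I j else 0)" for j
    define hi where "hi j = (if j \<in> X then deadline I j - psize I j (y (a j)) else 0)" for j
    define low where "low j = (if k = J21 \<and> y (a j) = TypeA then lo j else phase_end Q \<epsilon> i)" for j
    define types where "types \<longleftrightarrow> (\<forall>j\<in>X. y (a j) \<in> allowed_types k)"
    define disj where "disj = (\<Inter>(j, l)\<in>{(j, l). j \<in> X \<and> l \<in> X \<and> j \<noteq> l \<and> a j = a l}.
      {s. s j + psize I j (y (a j)) \<le> s l} \<union> {s. s l + psize I l (y (a l)) \<le> s j})"
    \<comment> \<open>For a fixed assignment, releases, deadlines and the phase end bound each start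
      separately, outside \<open>X\<close> the interval is the point \<open>0\<close>, and
      disjointness is an intersection of unions of two closed half-spaces.\<close>
    have "K f = (if types then {s. \<forall>j. s j \<in> {(if j \<in> X then max (lo j) (low j) else 0)..hi j}} \<inter> disj else {})"
      unfolding K_def t_admissible_def t_feasible_def X_def[symmetric] f sched_def lo_def hi_def
        low_def types_def disj_def
      by (auto simp: t_finish_def algebra_simps split: if_splits; meson order_antisym)
    moreover have "closed disj"
      unfolding disj_def by (intro closed_INT ballI) (auto intro!: closed_Un closed_less_eq_coordinate)
    then have "compact ({s. \<forall>j. s j \<in> {(if j \<in> X then max (lo j) (low j) else 0)..hi j}} \<inter> disj)"
      by (intro compact_Int_closed compact_box)
    ultimately show ?thesis
      by (cases types) (simp_all only: if_True if_False compact_empty)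
  qed
  moreover have cont: "continuous_on UNIV (\<lambda>s. t_cost Q I X (sched f s))" for f
    using X unfolding t_cost_def t_machines_def t_to_def t_from_def t_finish_def sched_def
    by (cases f) (auto intro!: continuous_intros continuous_on_Max_image continuous_on_Min_image
        continuous_on_product_coordinates)
  ultimately have "compact C"
    unfolding C_def using \<open>finite F\<close>
    by (intro compact_UN ballI compact_continuous_image continuous_on_subset[OF cont]) simp_all
  have in_C: "t_cost Q I X T \<in> C" if T: "t_admissible Q \<epsilon> I i k T" for T
  proof -
    \<comment> \<open>A machine is renamed to its job of smallest number; this is injective because
      a job is on one machine only.\<close>
    define h where "h m = Min {j\<in>X. t_assign T j = m}" for m
    have h: "h m \<in> {j\<in>X. t_assign T j = m}" if "m \<in> t_machines X T" for m
      unfolding h_def using that X by (intro Min_in) (auto simp: t_machines_def)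
    then have inj: "inj_on h (t_machines X T)"
      by (auto simp: inj_on_def) metis
    define a where "a j = (if j \<in> X then h (t_assign T j) else 0)" for j
    define y where "y j = (if j \<in> X then t_type T (t_assign T j) else TypeA)" for j
    define s where "s j = (if j \<in> X then t_start T j else 0)" for j
    have m: "j \<in> X \<Longrightarrow> t_assign T j \<in> t_machines X T" for j
      by (simp add: t_machines_def)
    have aF: "(a, y) \<in> F"
      using h m by (auto simp: F_def a_def y_def)
    have ty: "t_type (sched (a, y) s) (h m) = t_type T m" if "m \<in> t_machines X T" for m
      using h[OF that] by (auto simp: sched_def y_def)
    note ren = t_rename[OF inj, of "sched (a, y) s", OF _ _ ty]
    have "t_cost Q I X (sched (a, y) s) = t_cost Q I X T"
      by (rule ren) (auto simp: sched_def a_def s_def)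
    moreover have "t_feasible I X (sched (a, y) s) = t_feasible I X T"
      by (rule ren) (auto simp: sched_def a_def s_def)
    then have "s \<in> K (a, y)"
      using T ty m unfolding K_def t_admissible_def X_def[symmetric]
      by (auto simp: s_def) (auto simp: sched_def a_def s_def)
    ultimately show ?thesis
      using aF unfolding C_def by (metis (mono_tags, lifting) UN_I image_eqI)
  qed
  then have "C \<noteq> {}"
    using adm by blast
  then obtain x where "x \<in> C" "\<And>y. y \<in> C \<Longrightarrow> x \<le> y"
    using compact_attains_inf[OF \<open>compact C\<close>] by blast
  then show ?thesis
    using that in_C unfolding C_def K_def by fastforce
qed

text \<open>A minimum cost schedule is adapted to the last condition of \<open>tentative\<close>:
  each machine that begins after the phase end is moved earlier by the excess \<open>c m\<close>.
  This keeps all spans, hence the minimality.\<close>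

lemma tentative_exists:
  assumes "finite (batch Q \<epsilon> I i k)" and adm: "t_admissible Q \<epsilon> I i k T0"
  obtains T where "tentative Q \<epsilon> I i k T"
proof -
  define X where "X = batch Q \<epsilon> I i k"
  have X: "finite X"
    using assms by (simp add: X_def)
  obtain T where T: "t_admissible Q \<epsilon> I i k T"
    and T_min: "\<And>T'. t_admissible Q \<epsilon> I i k T' \<Longrightarrow> t_cost Q I X T \<le> t_cost Q I X T'"
    using min_cost_exists[OF assms] unfolding X_def by blast
  define c where "c m = max 0 (t_from X T m - phase_end Q \<epsilon> i)" for m
  define T' where "T' = T\<lparr>t_start := \<lambda>j. t_start T j - c (t_assign T j)\<rparr>"
  have T'_simps: "t_assign T' = t_assign T" "t_type T' = t_type T"
    "t_start T' j = t_start T j - c (t_assign T j)" "t_finish I T' j = t_finish I T j - c (t_assign T j)"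
    "t_machines X T' = t_machines X T" for j
    by (simp_all add: T'_def t_finish_def t_machines_def)
  have from': "t_from X T' m = t_from X T m - c m" and to': "t_to I X T' m = t_to I X T m - c m"
    if m: "m \<in> t_machines X T" for m
  proof -
    have ne: "{j \<in> X. t_assign T j = m} \<noteq> {}" "finite {j \<in> X. t_assign T j = m}"
      using m X by (auto simp: t_machines_def)
    have "t_from X T' m = Min ((\<lambda>j. t_start T j + - c m) ` {j \<in> X. t_assign T j = m})"
      unfolding t_from_def T'_simps by (intro arg_cong[where f = Min] image_cong) auto
    then show "t_from X T' m = t_from X T m - c m"
      using Min_add_commute[OF ne(2,1), of "t_start T" "- c m"] by (simp add: t_from_def)
    have "t_to I X T' m = Max ((\<lambda>j. t_finish I T j + - c m) ` {j \<in> X. t_assign T j = m})"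
      unfolding t_to_def T'_simps by (intro arg_cong[where f = Max] image_cong) auto
    then show "t_to I X T' m = t_to I X T m - c m"
      using Max_add_commute[OF ne(2,1), of "t_finish I T" "- c m"] by (simp add: t_to_def)
  qed
  have "t_cost Q I X T' = t_cost Q I X T"
    by (rule t_cost_congs[where h = id]) (auto simp: T'_simps from' to')
  moreover have "t_admissible Q \<epsilon> I i k T'"
  proof -
    \<comment> \<open>A moved machine begins exactly at the phase end, so its jobs still start after
      all releases of the batch.\<close>
    have start: "t_start T' j = t_start T j \<or> phase_end Q \<epsilon> i \<le> t_start T' j" if "j \<in> X" for j
      using t_from_le[OF X that refl, of T] by (auto simp: T'_simps c_def)
    have "release I j \<le> phase_end Q \<epsilon> i" if "j \<in> X" for j
      using that by (simp add: X_def batch_def)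
    then have "release I j \<le> t_start T' j" if "j \<in> X" for j
      using start[OF that] T that unfolding t_admissible_def t_feasible_def X_def[symmetric] by fastforce
    moreover have "t_finish I T' j \<le> deadline I j" if "j \<in> X" for j
    proof -
      have "t_finish I T j \<le> deadline I j"
        using T that unfolding t_admissible_def t_feasible_def X_def[symmetric] by blast
      then show ?thesis
        by (simp add: T'_simps c_def)
    qed
    moreover have "t_finish I T' j \<le> t_start T' l \<or> t_finish I T' l \<le> t_start T' j"
      if "j \<in> X" "l \<in> X" "j \<noteq> l" "t_assign T' j = t_assign T' l" for j l
      using T that unfolding t_admissible_def t_feasible_def X_def[symmetric] by (auto simp: T'_simps)
    moreover have "phase_end Q \<epsilon> i \<le> t_start T' j"
      if "j \<in> X" "\<not> (k = J21 \<and> t_type T (t_assign T j) = TypeA)" for j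
      using start[OF that(1)] T that unfolding t_admissible_def X_def[symmetric] by fastforce
    ultimately show ?thesis
      using T unfolding t_admissible_def t_feasible_def X_def[symmetric] by (auto simp: T'_simps)
  qed
  moreover have "t_from X T' m \<le> phase_end Q \<epsilon> i" if "m \<in> t_machines X T'" for m
    using that from' by (auto simp: T'_simps c_def)
  ultimately have "tentative Q \<epsilon> I i k T'"
    using T_min unfolding tentative_def X_def[symmetric] by simp
  then show ?thesis
    using that by blast
qed

section \<open>Packing jobs into buckets\<close>

text \<open>The start of job \<open>j\<close> if all jobs of its type were run back to back from
  time 0 on a single machine, in the order of their numbers.\<close>

definition load :: "inst \<Rightarrow> nat set \<Rightarrow> (nat \<Rightarrow> mtype) \<Rightarrow> nat \<Rightarrow> real" where
  "load I X \<tau> j = (\<Sum>k\<in>{k\<in>X. \<tau> k = \<tau> j \<and> k < j}. psize I k (\<tau> k))"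

text \<open>Bucket \<open>b\<close> of a type contains the jobs whose load lies between \<open>b * D\<close> and \<open>(b + 1) * D\<close>;
  it is machine \<open>2 * b\<close> for type A and machine \<open>2 * b + 1\<close> for type B.\<close>

definition pack :: "inst \<Rightarrow> nat set \<Rightarrow> (nat \<Rightarrow> mtype) \<Rightarrow> real \<Rightarrow> real \<Rightarrow> tent" where
  "pack I X \<tau> D t =
     \<lparr>t_assign = \<lambda>j. 2 * nat \<lfloor>load I X \<tau> j / D\<rfloor> + (if \<tau> j = TypeA then 0 else 1),
      t_type = \<lambda>m. if even m then TypeA else TypeB,
      t_start = \<lambda>j. t + load I X \<tau> j - D * real_of_int \<lfloor>load I X \<tau> j / D\<rfloor>\<rparr>"

locale packing =
  fixes I :: inst and X :: "nat set" and \<tau> :: "nat \<Rightarrow> mtype" and D t :: real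
  assumes finX: "finite X" and D: "0 < D"
    and size_nonneg: "\<And>j. j \<in> X \<Longrightarrow> 0 \<le> psize I j (\<tau> j)"
begin

abbreviation "T \<equiv> pack I X \<tau> D t"

abbreviation "len j \<equiv> psize I j (\<tau> j)"

lemma size_nonneg': "j \<in> X \<Longrightarrow> \<tau> j = \<upsilon> \<Longrightarrow> 0 \<le> psize I j \<upsilon>"
  using size_nonneg by blast

lemma load_nonneg: "0 \<le> load I X \<tau> j"
  unfolding load_def by (intro sum_nonneg) (blast intro: size_nonneg')

lemma floor_nonneg: "0 \<le> \<lfloor>load I X \<tau> j / D\<rfloor>"
  using load_nonneg D by simp

lemma load_add_size_le:
  assumes "j \<in> X" "\<tau> j = \<tau> k" "j < k"
  shows "load I X \<tau> j + len j \<le> load I X \<tau> k"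
proof -
  have "load I X \<tau> j + len j = (\<Sum>l\<in>insert j {l\<in>X. \<tau> l = \<tau> j \<and> l < j}. len l)"
    using finX by (simp add: load_def)
  also have "\<dots> \<le> load I X \<tau> k"
    unfolding load_def using assms finX by (intro sum_mono2) (auto intro: size_nonneg')
  finally show ?thesis .
qed

lemma pack_type: "t_type T (t_assign T j) = \<tau> j"
  by (cases "\<tau> j") (auto simp: pack_def)

lemma same_machine_iff:
  "t_assign T j = t_assign T k \<longleftrightarrow> \<tau> j = \<tau> k \<and> \<lfloor>load I X \<tau> j / D\<rfloor> = \<lfloor>load I X \<tau> k / D\<rfloor>"
proof
  assume eq: "t_assign T j = t_assign T k"
  then have "\<tau> j = \<tau> k"
    by (metis pack_type)
  moreover have "nat \<lfloor>load I X \<tau> j / D\<rfloor> = nat \<lfloor>load I X \<tau> k / D\<rfloor>"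
    using eq \<open>\<tau> j = \<tau> k\<close> by (simp add: pack_def)
  ultimately show "\<tau> j = \<tau> k \<and> \<lfloor>load I X \<tau> j / D\<rfloor> = \<lfloor>load I X \<tau> k / D\<rfloor>"
    using floor_nonneg[of j] floor_nonneg[of k] by (simp add: nat_eq_iff)
qed (simp add: pack_def)

lemma pack_finish: "t_finish I T j = t_start T j + len j"
  by (simp add: t_finish_def pack_type)

text \<open>The offset of a start from \<open>t\<close> is the load modulo \<open>D\<close>; hence
  this bound and the one by \<open>t + D\<close>.\<close>

lemma pack_start_ge: "t \<le> t_start T j"
  using floor_divide_lower[OF D, of "load I X \<tau> j"] by (simp add: pack_def mult.commute)

lemma pack_start_less: "t_start T j < t + D"
proof -
  have "load I X \<tau> j / D < real_of_int \<lfloor>load I X \<tau> j / D\<rfloor> + 1"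
    by linarith
  then have "load I X \<tau> j < D * (real_of_int \<lfloor>load I X \<tau> j / D\<rfloor> + 1)"
    using D by (simp add: field_simps)
  then show ?thesis
    by (simp add: pack_def algebra_simps)
qed

text \<open>For batches of total length below \<open>D\<close>, where jobs have to end, not only to
  start, before \<open>t + D\<close>.\<close>

lemma pack_start_le_load: "t_start T j \<le> t + load I X \<tau> j"
  using D floor_nonneg[of j] by (simp add: pack_def)

lemma load_add_size_le_sum:
  assumes "j \<in> X"
  shows "load I X \<tau> j + len j \<le> (\<Sum>k\<in>{k\<in>X. \<tau> k = \<tau> j}. len k)"
proof -
  have "load I X \<tau> j + len j = (\<Sum>l\<in>insert j {l\<in>X. \<tau> l = \<tau> j \<and> l < j}. len l)"
    using finX by (simp add: load_def)
  also have "\<dots> \<le> (\<Sum>k\<in>{k\<in>X. \<tau> k = \<tau> j}. len k)"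
    using assms finX by (intro sum_mono2) (auto intro: size_nonneg')
  finally show ?thesis .
qed

text \<open>On a common machine the floors agree, so starts differ exactly as loads do, and loads
  are the starts of a sequential schedule.\<close>

lemma pack_disjoint:
  assumes "j \<in> X" "k \<in> X" "j \<noteq> k" "t_assign T j = t_assign T k"
  shows "t_finish I T j \<le> t_start T k \<or> t_finish I T k \<le> t_start T j"
  using assms load_add_size_le[of j k] load_add_size_le[of k j]
  unfolding same_machine_iff pack_finish by (cases j k rule: linorder_cases) (auto simp: pack_def)

lemma load_mono:
  assumes "\<tau> j = \<tau> k" "j \<le> k"
  shows "load I X \<tau> j \<le> load I X \<tau> k"
  unfolding load_def using assms finX by (intro sum_mono2) (auto intro: size_nonneg')

text \<open>The jobs of a bucket follow each other without idle time.\<close>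

lemma pack_span:
  assumes m: "m \<in> t_machines X T"
  shows "t_to I X T m - t_from X T m \<le> (\<Sum>j\<in>{j\<in>X. t_assign T j = m}. len j)"
proof -
  obtain f where f: "f \<in> X" "t_assign T f = m" "t_start T f = t_from X T m"
    using t_from_attained[OF finX m] .
  obtain l where l: "l \<in> X" "t_assign T l = m" "t_finish I T l = t_to I X T m"
    using t_to_attained[OF finX m] .
  have same: "\<tau> f = \<tau> l" "\<lfloor>load I X \<tau> f / D\<rfloor> = \<lfloor>load I X \<tau> l / D\<rfloor>"
    using f(2) l(2) same_machine_iff by metis+
  then have "t_to I X T m - t_from X T m = load I X \<tau> l + len l - load I X \<tau> f"
    unfolding f(3)[symmetric] l(3)[symmetric] pack_finish by (simp add: pack_def)
  also have "\<dots> \<le> (\<Sum>j\<in>{j\<in>X. t_assign T j = m}. len j)"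
  \<comment> \<open>Lengths may be 0 in this locale, so the job attaining the last completion may
    precede the one attaining the first start; the span is then at most 0.\<close>
  proof (cases "l < f")
    case True
    then show ?thesis
      using load_add_size_le[OF l(1), of f] same
        sum_nonneg[of "{j\<in>X. t_assign T j = m}" len] size_nonneg by auto
  next
    case False
    let ?P = "\<lambda>j. {k\<in>X. \<tau> k = \<tau> j \<and> k < j}"
    \<comment> \<open>The block of jobs numbered from \<open>f\<close> to \<open>l\<close>: their
      loads lie between two loads with equal floors, so all of them are in this bucket.\<close>
    let ?B = "{k\<in>X. \<tau> k = \<tau> l \<and> f \<le> k \<and> k \<le> l}"
    have "load I X \<tau> l + len l = (\<Sum>j\<in>insert l (?P l). len j)"
      using finX by (simp add: load_def)
    also have "insert l (?P l) = ?P f \<union> ?B"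
      using False same l(1) by auto
    also have "(\<Sum>j\<in>?P f \<union> ?B. len j) = load I X \<tau> f + (\<Sum>j\<in>?B. len j)"
      unfolding load_def using finX by (intro sum.union_disjoint) auto
    finally have "load I X \<tau> l + len l - load I X \<tau> f = (\<Sum>j\<in>?B. len j)"
      by simp
    also have "\<dots> \<le> (\<Sum>j\<in>{j\<in>X. t_assign T j = m}. len j)"
    proof (rule sum_mono2)
      show "?B \<subseteq> {j\<in>X. t_assign T j = m}"
      proof
        fix k assume k: "k \<in> ?B"
        then have "load I X \<tau> f \<le> load I X \<tau> k" "load I X \<tau> k \<le> load I X \<tau> l"
          using load_mono same by auto
        then have "\<lfloor>load I X \<tau> f / D\<rfloor> \<le> \<lfloor>load I X \<tau> k / D\<rfloor>" "\<lfloor>load I X \<tau> k / D\<rfloor> \<le> \<lfloor>load I X \<tau> l / D\<rfloor>"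
          using D by (auto intro!: floor_mono divide_right_mono)
        then have "t_assign T k = t_assign T l"
          using k same unfolding same_machine_iff by auto
        then show "k \<in> {j\<in>X. t_assign T j = m}"
          using k l by auto
      qed
    qed (use finX size_nonneg in auto)
    finally show ?thesis .
  qed
  finally show ?thesis .
qed

text \<open>No load exceeds the total length of the type, so only the bucket numbers from 0 to
  \<open>?n\<close> occur; the \<open>1\<close> stands for the last bucket, which may be poorly
  filled.\<close>

lemma pack_card:
  "real (card {m\<in>t_machines X T. t_type T m = \<upsilon>}) \<le> (\<Sum>k\<in>{k\<in>X. \<tau> k = \<upsilon>}. len k) / D + 1"
proof -
  let ?P = "\<Sum>k\<in>{k\<in>X. \<tau> k = \<upsilon>}. len k"
  let ?n = "nat \<lfloor>?P / D\<rfloor>"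
  have "{m\<in>t_machines X T. t_type T m = \<upsilon>} \<subseteq> (\<lambda>b. 2 * b + (if \<upsilon> = TypeA then 0 else 1)) ` {..?n}"
  proof
    fix m assume "m \<in> {m\<in>t_machines X T. t_type T m = \<upsilon>}"
    then obtain j where j: "j \<in> X" "m = t_assign T j" "\<tau> j = \<upsilon>"
      by (auto simp: t_machines_def pack_type)
    then have "load I X \<tau> j \<le> ?P"
      using load_add_size_le_sum[of j] size_nonneg[of j] by auto
    then have "nat \<lfloor>load I X \<tau> j / D\<rfloor> \<le> ?n"
      using D by (intro nat_mono floor_mono divide_right_mono) auto
    then show "m \<in> (\<lambda>b. 2 * b + (if \<upsilon> = TypeA then 0 else 1)) ` {..?n}"
      using j by (intro image_eqI[of _ _ "nat \<lfloor>load I X \<tau> j / D\<rfloor>"]) (auto simp: pack_def)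
  qed
  then have "card {m\<in>t_machines X T. t_type T m = \<upsilon>} \<le> card {..?n}"
    by (rule surj_card_le[rotated]) simp
  moreover have "0 \<le> ?P / D"
    using D size_nonneg by (intro divide_nonneg_pos sum_nonneg) auto
  then have "real ?n \<le> ?P / D"
    by linarith
  ultimately show ?thesis
    by simp
qed

text \<open>Setups are counted by \<open>pack_card\<close>, working times are bounded by
  \<open>pack_span\<close>. The sum runs only over the types in use, so that a batch on type A alone
  pays no additive setup of type B.\<close>

lemma pack_cost:
  assumes rate: "\<And>\<upsilon>. 0 \<le> rate Q \<upsilon>" and setups: "\<And>\<upsilon>. 0 \<le> setup_time Q \<upsilon>"
  shows "t_cost Q I X T \<le>
    (\<Sum>\<upsilon>\<in>\<tau> ` X. rate Q \<upsilon> * setup_time Q \<upsilon> * ((\<Sum>j\<in>{j\<in>X. \<tau> j = \<upsilon>}. len j) / D + 1)) +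
    (\<Sum>j\<in>X. rate Q (\<tau> j) * len j)"
proof -
  let ?M = "t_machines X T"
  have finM: "finite ?M"
    using finX by (simp add: t_machines_def)
  have "t_cost Q I X T \<le> (\<Sum>m\<in>?M. rate Q (t_type T m) * setup_time Q (t_type T m) +
      (\<Sum>j\<in>{j\<in>X. t_assign T j = m}. rate Q (\<tau> j) * len j))"
    unfolding t_cost_def
  proof (rule sum_mono)
    fix m assume m: "m \<in> ?M"
    have "rate Q (t_type T m) * (t_to I X T m - t_from X T m)
        \<le> rate Q (t_type T m) * (\<Sum>j\<in>{j\<in>X. t_assign T j = m}. len j)"
      by (intro mult_left_mono pack_span m rate)
    also have "\<dots> = (\<Sum>j\<in>{j\<in>X. t_assign T j = m}. rate Q (\<tau> j) * len j)"
      unfolding sum_distrib_left by (intro sum.cong) (auto simp: pack_type)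
    finally show "rate Q (t_type T m) * (setup_time Q (t_type T m) + t_to I X T m - t_from X T m)
        \<le> rate Q (t_type T m) * setup_time Q (t_type T m) +
          (\<Sum>j\<in>{j\<in>X. t_assign T j = m}. rate Q (\<tau> j) * len j)"
      by (simp add: algebra_simps)
  qed
  also have "\<dots> = (\<Sum>m\<in>?M. rate Q (t_type T m) * setup_time Q (t_type T m)) +
      (\<Sum>m\<in>?M. \<Sum>j\<in>{j\<in>X. t_assign T j = m}. rate Q (\<tau> j) * len j)"
    by (rule sum.distrib)
  also have "(\<Sum>m\<in>?M. \<Sum>j\<in>{j\<in>X. t_assign T j = m}. rate Q (\<tau> j) * len j)
      = (\<Sum>j\<in>X. rate Q (\<tau> j) * len j)"
    using finX by (intro sum.group) (auto simp: t_machines_def)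
  also have "(\<Sum>m\<in>?M. rate Q (t_type T m) * setup_time Q (t_type T m))
      = (\<Sum>\<upsilon>\<in>\<tau> ` X. \<Sum>m\<in>{m\<in>?M. t_type T m = \<upsilon>}. rate Q (t_type T m) * setup_time Q (t_type T m))"
    using finX finM by (intro sum.group[symmetric]) (auto simp: t_machines_def pack_type)
  also have "\<dots> = (\<Sum>\<upsilon>\<in>\<tau> ` X. rate Q \<upsilon> * setup_time Q \<upsilon> * card {m\<in>?M. t_type T m = \<upsilon>})"
    by (intro sum.cong refl) simp
  also have "\<dots> \<le> (\<Sum>\<upsilon>\<in>\<tau> ` X. rate Q \<upsilon> * setup_time Q \<upsilon> * ((\<Sum>j\<in>{j\<in>X. \<tau> j = \<upsilon>}. len j) / D + 1))"
    by (intro sum_mono mult_left_mono pack_card mult_nonneg_nonneg rate setups)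
  finally show ?thesis
    by simp
qed

end

section \<open>The algorithm produces feasible schedules\<close>

lemma tighten_simps [simp]:
  "jobs (tighten Q I) = jobs I" "release (tighten Q I) = release I" "psize (tighten Q I) = psize I"
  "deadline (tighten Q I) j = deadline I j - setup_time Q TypeB"
  by (simp_all add: tighten_def)

lemma class_jobs_subset: "class_jobs Q \<epsilon> I k \<subseteq> jobs I"
  by (cases k) (auto simp: J21_jobs_def J2_jobs_def)

lemma class_jobs_unique: "j \<in> class_jobs Q \<epsilon> I k \<Longrightarrow> j \<in> class_jobs Q \<epsilon> I k' \<Longrightarrow> k = k'"
  by (cases k; cases k') (auto simp: J21_jobs_def J2_jobs_def split: if_splits)

section \<open>Parameters of an instance and the slack left after tightening\<close>

locale dispatch =
  fixes Q :: cloud and \<epsilon> :: real and I :: inst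
  assumes cloud: "normalized_cloud Q" and eps: "0 < \<epsilon>" "\<epsilon> \<le> 1"
    and valid: "valid_inst I" and slack_ge: "min_slack ((1 + \<epsilon>) * setup_time Q TypeB) I"
begin

abbreviation "s \<equiv> setup_time Q"
abbreviation "c \<equiv> rate Q TypeB"
abbreviation "D \<equiv> Delta Q \<epsilon>"
abbreviation "J \<equiv> tighten Q I"
abbreviation "B \<equiv> batch Q \<epsilon> J"
abbreviation "P \<equiv> phase_end Q \<epsilon>"

lemma setup_pos: "0 < s \<tau>"
  using cloud by (cases \<tau>) (auto simp: normalized_cloud_def)

lemma setup_le: "s \<tau> \<le> s TypeB"
  using cloud by (cases \<tau>) (auto simp: normalized_cloud_def)

lemma rate_A: "rate Q TypeA = 1"
  using cloud by (simp add: normalized_cloud_def)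

lemma rate_ge: "1 \<le> rate Q \<tau>"
  using cloud by (cases \<tau>) (auto simp: normalized_cloud_def)

lemma rate_le: "rate Q \<tau> \<le> c"
  using cloud by (cases \<tau>) (auto simp: normalized_cloud_def)

lemma D_pos: "0 < D"
  using eps setup_pos[of TypeB] by (simp add: Delta_def)

lemma setup_B: "s TypeB = 2 / \<epsilon> * D"
  using eps by (simp add: Delta_def)

lemma finite_jobs: "finite (jobs I)"
  using valid by (simp add: valid_inst_def)

lemma psize_ge: "j \<in> jobs I \<Longrightarrow> 1 \<le> psize I j \<tau>"
  using valid by (simp add: valid_inst_def)

lemma release_nonneg: "j \<in> jobs I \<Longrightarrow> 0 \<le> release I j"
  using valid by (simp add: valid_inst_def)

text \<open>Tightening takes \<open>s TypeB\<close> from the slack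
  \<open>(1 + \<epsilon>) * s TypeB\<close>, and the rest \<open>\<epsilon> * s TypeB\<close> is
  \<open>2 * D\<close>.\<close>

lemma slack_tighten:
  assumes "j \<in> jobs I"
  shows "2 * D \<le> slack J j TypeA \<or> 2 * D \<le> slack J j TypeB"
proof -
  have "(1 + \<epsilon>) * s TypeB \<le> slack I j TypeA \<or> (1 + \<epsilon>) * s TypeB \<le> slack I j TypeB"
    using assms slack_ge by (auto simp: min_slack_def le_max_iff_disj)
  then show ?thesis
    by (auto simp: slack_def Delta_def algebra_simps)
qed

text \<open>Slack \<open>2 * D\<close> on type B leads to \<open>J1\<close>, \<open>J21\<close> or
  \<open>J22\<close>; a job without it has slack \<open>2 * D\<close> on type A and is in
  \<open>J3\<close>.\<close>

lemma class_exists: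
  assumes "j \<in> jobs I"
  obtains k where "j \<in> class_jobs Q \<epsilon> J k"
proof -
  have "\<exists>k. j \<in> class_jobs Q \<epsilon> J k"
  proof (rule ccontr)
    assume "\<nexists>k. j \<in> class_jobs Q \<epsilon> J k"
    then have "j \<notin> class_jobs Q \<epsilon> J k" for k
      by blast
    from this[of J1] this[of J21] this[of J22] this[of J3] show False
      using slack_tighten[OF assms] assms by (auto simp: J2_jobs_def not_le)
  qed
  then show ?thesis
    using that by blast
qed

section \<open>Phases and batches\<close>

definition phase :: "nat \<Rightarrow> nat" where
  "phase j = nat \<lfloor>release I j / D\<rfloor> + 1"

lemma phase_iff:
  assumes "j \<in> jobs I" "1 \<le> i"
  shows "P (i - 1) \<le> release I j \<and> release I j < P i \<longleftrightarrow> i = phase j"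
proof -
  obtain n where n: "i = Suc n"
    using assms(2) by (cases i) auto
  have "P (i - 1) \<le> release I j \<and> release I j < P i \<longleftrightarrow> \<lfloor>release I j / D\<rfloor> = int n"
    using D_pos by (simp add: n phase_end_def floor_eq_iff field_simps)
  also have "\<dots> \<longleftrightarrow> i = phase j"
    using n release_nonneg[OF assms(1)] D_pos by (auto simp: phase_def)
  finally show ?thesis .
qed

lemma batch_iff: "1 \<le> i \<Longrightarrow> j \<in> B i k \<longleftrightarrow> j \<in> class_jobs Q \<epsilon> J k \<and> i = phase j"
  using phase_iff[of j i] class_jobs_subset[of Q \<epsilon> J k] by (auto simp: batch_def)

lemma phase_ge: "1 \<le> phase j"
  by (simp add: phase_def)

lemma batch_jobs: "j \<in> B i k \<Longrightarrow> j \<in> jobs I"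
  using class_jobs_subset[of Q \<epsilon> J k] by (auto simp: batch_def)

lemma finite_batch: "finite (B i k)"
  using batch_jobs by (intro finite_subset[OF _ finite_jobs]) auto

lemma P_diff: "1 \<le> i \<Longrightarrow> P (i - 1) = P i - D"
  by (simp add: phase_end_def of_nat_diff algebra_simps)

lemma packing_batch: "packing J (B i k) \<tau> D"
proof
  fix j assume "j \<in> B i k"
  then show "0 \<le> psize J j (\<tau> j)"
    using psize_ge[OF batch_jobs, of j i k "\<tau> j"] by simp
qed (auto simp: finite_batch D_pos)

lemma pack_admissible:
  assumes "\<And>j. j \<in> B i k \<Longrightarrow> \<tau> j \<in> allowed_types k"
    and "\<And>j. j \<in> B i k \<Longrightarrow> t_finish J (pack J (B i k) \<tau> D (P i)) j \<le> deadline J j"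
  shows "t_admissible Q \<epsilon> J i k (pack J (B i k) \<tau> D (P i))"
proof -
  interpret packing J "B i k" \<tau> D "P i"
    by (rule packing_batch)
  have "release J j \<le> t_start T j" if "j \<in> B i k" for j
    using pack_start_ge[of j] that by (auto simp: batch_def)
  then show ?thesis
    using assms pack_start_ge pack_disjoint by (auto simp: t_admissible_def t_feasible_def pack_type)
qed

text \<open>A job of the batch is released at most \<open>D\<close> before the phase end and starts
  less than \<open>D\<close> after it; slack \<open>2 * D\<close> absorbs both.\<close>

lemma pack_finish_le:
  assumes "1 \<le> i" "j \<in> B i k" "2 * D \<le> slack J j (\<tau> j)"
  shows "t_finish J (pack J (B i k) \<tau> D (P i)) j \<le> deadline J j"
proof -
  interpret packing J "B i k" \<tau> D "P i"
    by (rule packing_batch)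
  have "P i - D \<le> release I j"
    using assms P_diff by (simp add: batch_def)
  then show ?thesis
    using assms(3) pack_start_less[of j] by (auto simp: pack_finish slack_def)
qed

lemma slack_B: "j \<in> B i k \<Longrightarrow> k \<noteq> J3 \<Longrightarrow> 2 * D \<le> slack J j TypeB"
  by (cases k) (auto simp: batch_def J21_jobs_def J2_jobs_def split: if_splits)

lemma slack_J3: "j \<in> B i J3 \<Longrightarrow> 2 * D \<le> slack J j TypeA \<and> slack J j TypeB < 2 * D"
  by (auto simp: batch_def)

lemma slack_J2:
  assumes "j \<in> B i k" "k = J21 \<or> k = J22"
  shows "slack J j TypeA < 2 * D" "D < psize I j TypeA"
  using assms by (auto simp: batch_def J21_jobs_def J2_jobs_def split: if_splits)

text \<open>A packing on type A for \<open>J3\<close> and on type B for the other classes is always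
  admissible, so the minimum is taken over a nonempty set.\<close>

lemma tentative_schedule_exists:
  assumes i: "1 \<le> i"
  shows "\<exists>T. tentative Q \<epsilon> J i k T"
proof -
  define \<tau> :: "nat \<Rightarrow> mtype" where "\<tau> = (\<lambda>_. if k = J3 then TypeA else TypeB)"
  have slack: "2 * D \<le> slack J j (\<tau> j)" if "j \<in> B i k" for j
    using slack_B[OF that] slack_J3 that by (auto simp: \<tau>_def)
  have "t_admissible Q \<epsilon> J i k (pack J (B i k) \<tau> D (P i))"
    using slack pack_finish_le[OF i] by (intro pack_admissible) (cases k; auto simp: \<tau>_def)+
  then show ?thesis
    using tentative_exists[OF finite_batch] by blast
qed

end

section \<open>A run with fixed tentative schedules and fixed early machines\<close>

locale dispatch_run = dispatch +
  fixes T :: "nat \<Rightarrow> jclass \<Rightarrow> tent" and g :: "nat \<Rightarrow> nat \<Rightarrow> nat"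
  assumes tentative: "\<And>i k. 1 \<le> i \<Longrightarrow> tentative Q \<epsilon> J i k (T i k)"
    and early: "\<And>i. 1 \<le> i \<Longrightarrow> early_choice Q \<epsilon> J i (T i J21) (g i)"
begin

abbreviation "H \<equiv> host Q \<epsilon> J T g"
abbreviation "Mach i k \<equiv> t_machines (B i k) (T i k)"
abbreviation "begins i k \<equiv> t_from (B i k) (T i k)"
abbreviation "ends i k \<equiv> t_to J (B i k) (T i k)"

lemma admissible: "1 \<le> i \<Longrightarrow> t_admissible Q \<epsilon> J i k (T i k)"
  using tentative by (auto simp: tentative_def)

lemma tent_job:
  assumes "1 \<le> i" "j \<in> B i k"
  shows "release I j \<le> t_start (T i k) j" "t_finish J (T i k) j \<le> deadline I j - s TypeB"
    "t_assign (T i k) j \<in> Mach i k"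
  using admissible[OF assms(1), of k] assms(2)
  by (auto simp: t_admissible_def t_feasible_def t_machines_def)

lemma finish_ge: "j \<in> B i k \<Longrightarrow> t_start (T i k) j \<le> t_finish J (T i k) j"
  using psize_ge[OF batch_jobs, of j i k "t_type (T i k) (t_assign (T i k) j)"]
  by (simp add: t_finish_def)

lemma early_props:
  assumes "1 \<le> i" "m \<in> Mach i k" "needs_early Q \<epsilon> J i k (T i k) m"
  shows "k = J21" "g i m \<in> B i J21" "release I (g i m) \<le> begins i k m"
  using early[OF assms(1)] assms(2,3) by (auto simp: early_choice_def Let_def needs_early_def)

text \<open>The name of a batch machine shows its index. An early machine is named by a job, which
  determines the phase; within the phase, \<open>g i\<close> is injective on the machines that need
  one.\<close>

lemma host_inj:
  assumes "1 \<le> i" "1 \<le> i'" "m \<in> Mach i k" "m' \<in> Mach i' k'" "H i k m = H i' k' m'"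
  shows "i = i' \<and> k = k' \<and> m = m'"
proof (cases "needs_early Q \<epsilon> J i k (T i k) m")
  case True
  then have e': "needs_early Q \<epsilon> J i' k' (T i' k') m'" and eq: "g i m = g i' m'"
    using assms(5) by (auto simp: host_def split: if_splits)
  have "g i m \<in> B i J21" "g i' m' \<in> B i' J21" "k = J21" "k' = J21"
    using early_props[OF assms(1,3) True] early_props[OF assms(2,4) e'] by auto
  moreover from this have "i = i'"
    using eq batch_iff assms(1,2) by metis
  moreover have "inj_on (g i) {m \<in> Mach i J21. needs_early Q \<epsilon> J i J21 (T i J21) m}"
    using early[OF assms(1)] by (simp add: early_choice_def Let_def)
  ultimately show ?thesis
    using eq True e' assms(3,4) by (auto simp: inj_on_def)
next
  case False
  then show ?thesis
    using assms(5) by (auto simp: host_def split: if_splits)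
qed

text \<open>The bound by \<open>s TypeB\<close> is why subtracting \<open>s TypeB\<close> from the
  deadlines suffices; for the longer delay \<open>s TypeA + D\<close> it is the first half of
  \<open>condC\<close>.\<close>

lemma delay_bounds: "0 \<le> delay Q \<epsilon> k \<tau>" "delay Q \<epsilon> k \<tau> \<le> s TypeB" "s \<tau> \<le> delay Q \<epsilon> k \<tau>"
  using D_pos setup_pos[of \<tau>] setup_le[of \<tau>] by (auto simp: delay_def condC_def)

lemma from_ge:
  assumes "1 \<le> i" "m \<in> Mach i k"
  shows "P i - D \<le> begins i k m"
    and "k \<noteq> J21 \<or> t_type (T i k) m = TypeB \<Longrightarrow> P i \<le> begins i k m"
proof -
  obtain j where j: "j \<in> B i k" "t_assign (T i k) j = m" "t_start (T i k) j = begins i k m"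
    using t_from_attained[OF finite_batch assms(2)] .
  show "P i - D \<le> begins i k m"
    using tent_job(1)[OF assms(1) j(1)] j(1,3) P_diff[OF assms(1)] by (simp add: batch_def)
  show "P i \<le> begins i k m" if "k \<noteq> J21 \<or> t_type (T i k) m = TypeB"
    using admissible[OF assms(1), of k] j that by (auto simp: t_admissible_def)
qed

text \<open>An early machine is opened no later than \<open>begins i k m\<close>. A machine opened
  at the phase end serves either a tentative machine that begins no earlier than that, or, under
  \<open>condC\<close>, one of type A that begins at most \<open>D\<close> before, for which the
  extra \<open>D\<close> in the delay makes up.\<close>

lemma open_le_from:
  assumes i: "1 \<le> i" and m: "m \<in> Mach i k"
  shows "opening_time Q \<epsilon> J (H i k m) + s (t_type (T i k) m) \<le> begins i k m + delay Q \<epsilon> k (t_type (T i k) m)"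
proof (cases "needs_early Q \<epsilon> J i k (T i k) m")
  case True
  then show ?thesis
    using early_props[OF i m True] delay_bounds(3)[of "t_type (T i k) m" k] by (simp add: host_def)
next
  case False
  show ?thesis
  proof (cases "k = J21 \<and> t_type (T i k) m = TypeA \<and> condC Q \<epsilon>")
    case True
    then show ?thesis
      using False from_ge(1)[OF i m] by (auto simp: host_def delay_def)
  next
    case nC: False
    then have "P i \<le> begins i k m"
      using False from_ge(2)[OF i m] by (cases "k = J21"; cases "t_type (T i k) m") (auto simp: needs_early_def)
    then show ?thesis
      using False nC by (auto simp: host_def delay_def)
  qed
qed

text \<open>An early machine opens less than \<open>D\<close> before the tentative one begins, and
  the span exceeds \<open>D\<close> because it contains a \<open>J2\<close> job on type A. Otherwise
  the rental begins at the phase end, which is not before \<open>begins i k m\<close>, and the delay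
  is at most twice the setup time, since \<open>D < s TypeA / c\<close> where it contains the extra
  \<open>D\<close>.\<close>

lemma rental_le:
  assumes i: "1 \<le> i" and m: "m \<in> Mach i k"
  shows "ends i k m + delay Q \<epsilon> k (t_type (T i k) m) - opening_time Q \<epsilon> J (H i k m)
    \<le> 2 * (s (t_type (T i k) m) + ends i k m - begins i k m)"
proof -
  obtain j where j: "j \<in> B i k" "t_assign (T i k) j = m"
    using m by (auto simp: t_machines_def)
  have span: "psize I j (t_type (T i k) m) \<le> ends i k m - begins i k m"
    using psize_le_span[OF finite_batch j, of J] by simp
  then have span0: "0 \<le> ends i k m - begins i k m"
    using psize_ge[OF batch_jobs[OF j(1)], of "t_type (T i k) m"] by linarith
  show ?thesis
  proof (cases "needs_early Q \<epsilon> J i k (T i k) m")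
    case True
    then have k: "k = J21" "\<not> condC Q \<epsilon>" "t_type (T i k) m = TypeA" "begins i k m < P i"
      by (auto simp: needs_early_def)
    have "P i - D \<le> release I (g i m)"
      using early_props[OF i m True] P_diff[OF i] by (simp add: batch_def)
    moreover have "D < psize I j TypeA"
      using slack_J2[OF j(1)] k by blast
    ultimately show ?thesis
      using True k span setup_pos[of TypeA] by (simp add: host_def delay_def)
  next
    case False
    have "begins i k m \<le> P i"
      using tentative[OF i, of k] m by (auto simp: tentative_def)
    moreover have "delay Q \<epsilon> k (t_type (T i k) m) \<le> 2 * s (t_type (T i k) m)"
    proof (cases "k = J21 \<and> t_type (T i k) m = TypeA \<and> condC Q \<epsilon>")
      case True
      then have "D < s TypeA / c"
        by (simp add: condC_def)
      also have "s TypeA / c \<le> s TypeA"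
        using rate_ge[of TypeB] setup_pos[of TypeA] by (simp add: divide_le_eq_1 field_simps)
      finally show ?thesis
        using True by (auto simp: delay_def)
    next
      case False
      then show ?thesis
        using setup_pos[of "t_type (T i k) m"] by (auto simp: delay_def)
    qed
    ultimately show ?thesis
      using False span0 by (simp add: host_def)
  qed
qed

section \<open>Existence and feasibility of the realization\<close>

definition idx :: "(nat \<times> jclass \<times> nat) set" where
  "idx = {(i, k, m). 1 \<le> i \<and> m \<in> Mach i k}"

definition hosting :: "nat \<times> jclass \<times> nat \<Rightarrow> mach_id" where
  "hosting = (\<lambda>(i, k, m). H i k m)"

lemma inj_hosting: "inj_on hosting idx"
proof (rule inj_onI)
  fix u v assume uv: "u \<in> idx" "v \<in> idx" "hosting u = hosting v"
  obtain i k m i' k' m' where eq: "u = (i, k, m)" "v = (i', k', m')"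
    by (metis prod_cases3)
  show "u = v"
    using uv host_inj[of i i' m k m' k'] unfolding eq by (simp add: hosting_def idx_def)
qed

lemma host_in_hosting: "1 \<le> i \<Longrightarrow> m \<in> Mach i k \<Longrightarrow> H i k m \<in> hosting ` idx"
  by (force simp: hosting_def idx_def)

lemma used_eq: "used_machines Q \<epsilon> J T g = hosting ` idx"
proof
  show "used_machines Q \<epsilon> J T g \<subseteq> hosting ` idx"
    using host_in_hosting by (auto simp: used_machines_def)
qed (auto simp: used_machines_def hosting_def idx_def)

lemma finite_idx: "finite idx"
proof -
  have "idx \<subseteq> (\<lambda>(j, k). (phase j, k, t_assign (T (phase j) k) j)) ` (jobs I \<times> UNIV)"
  proof
    fix u assume "u \<in> idx"
    then obtain i k j where "u = (i, k, t_assign (T i k) j)" "1 \<le> i" "j \<in> B i k"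
      by (auto simp: idx_def t_machines_def)
    then show "u \<in> (\<lambda>(j, k). (phase j, k, t_assign (T (phase j) k) j)) ` (jobs I \<times> UNIV)"
      using batch_jobs[of j i k] by (auto simp: batch_iff)
  qed
  then show ?thesis
    using finite_jobs by (meson finite_SigmaI finite_code finite_imageI finite_subset)
qed

lemma finite_early: "finite (early_machines Q \<epsilon> J)"
  using class_jobs_subset[of Q \<epsilon> J J21] finite_jobs
  by (auto simp: early_machines_def intro: finite_subset)

text \<open>\<open>inv_into\<close> recovers the tentative machine that \<open>M\<close> hosts. The
  default is meant for early machines hosting none.\<close>

definition machine_type :: "mach_id \<Rightarrow> mtype" where
  "machine_type M = (if M \<in> hosting ` idx
     then (let (i, k, m) = inv_into idx hosting M in t_type (T i k) m) else TypeA)"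

definition machine_close :: "mach_id \<Rightarrow> real" where
  "machine_close M = (if M \<in> hosting ` idx
     then (let (i, k, m) = inv_into idx hosting M in ends i k m + delay Q \<epsilon> k (t_type (T i k) m))
     else opening_time Q \<epsilon> J M + s TypeA)"

definition class_of :: "nat \<Rightarrow> jclass" where
  "class_of j = (THE k. j \<in> class_jobs Q \<epsilon> J k)"

lemma realization_exists: "\<exists>S. realizes Q \<epsilon> J T g S"
proof -
  have class_of: "class_of j = k" if "j \<in> class_jobs Q \<epsilon> J k" for j k
    unfolding class_of_def using that class_jobs_unique by blast
  have machine: "machine_type (H i k m) = t_type (T i k) m"
    "machine_close (H i k m) = ends i k m + delay Q \<epsilon> k (t_type (T i k) m)"
    if "1 \<le> i" "m \<in> Mach i k" for i k m
  proof -
    have "(i, k, m) \<in> idx" "H i k m = hosting (i, k, m)"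
      using that by (auto simp: idx_def hosting_def)
    then show "machine_type (H i k m) = t_type (T i k) m"
      "machine_close (H i k m) = ends i k m + delay Q \<epsilon> k (t_type (T i k) m)"
      using inv_into_f_f[OF inj_hosting] by (auto simp: machine_type_def machine_close_def)
  qed
  define S where "S = \<lparr>machines = used_machines Q \<epsilon> J T g \<union> early_machines Q \<epsilon> J,
    mach_type = machine_type, open_at = opening_time Q \<epsilon> J, close_at = machine_close,
    assigned = \<lambda>j. H (phase j) (class_of j) (t_assign (T (phase j) (class_of j)) j),
    start = \<lambda>j. t_start (T (phase j) (class_of j)) j + delay Q \<epsilon> (class_of j)
      (t_type (T (phase j) (class_of j)) (t_assign (T (phase j) (class_of j)) j))\<rparr>"
  \<comment> \<open>An early machine in use hosts a tentative machine that needs one, hence one of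
    type A.\<close>
  have "machine_type M = TypeA" if M: "M \<in> early_machines Q \<epsilon> J" for M
  proof (cases "M \<in> hosting ` idx")
    case True
    then obtain i k m where u: "1 \<le> i" "m \<in> Mach i k" "M = H i k m"
      by (auto simp: idx_def hosting_def)
    then have "needs_early Q \<epsilon> J i k (T i k) m"
      using M by (auto simp: host_def early_machines_def split: if_splits)
    then show ?thesis
      using machine u by (auto simp: needs_early_def)
  qed (simp add: machine_type_def)
  then have "realizes Q \<epsilon> J T g S"
    using machine unfolding realizes_def S_def
    by (auto simp: used_eq machine_close_def batch_iff class_of)
  then show ?thesis
    by blast
qed

text \<open>All jobs of one tentative machine are delayed by the same amount, so they stay disjoint;
  the tightened deadlines absorb the delay, and \<open>open_le_from\<close> leaves time for the
  setup.\<close>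

lemma feasible_realization:
  assumes S: "realizes Q \<epsilon> J T g S"
  shows "feasible Q I S"
  unfolding feasible_def
proof (intro conjI ballI impI)
  have machines: "machines S = hosting ` idx \<union> early_machines Q \<epsilon> J"
    and open_eq: "\<And>M. M \<in> machines S \<Longrightarrow> open_at S M = opening_time Q \<epsilon> J M"
    using S by (auto simp: realizes_def used_eq)
  have hosted: "mach_type S (H i k m) = t_type (T i k) m"
    "close_at S (H i k m) = ends i k m + delay Q \<epsilon> k (t_type (T i k) m)"
    if "1 \<le> i" "m \<in> Mach i k" for i k m
    using S that by (auto simp: realizes_def)
  have job: "assigned S j = H i k (t_assign (T i k) j)"
    "start S j = t_start (T i k) j + delay Q \<epsilon> k (t_type (T i k) (t_assign (T i k) j))"
    if "1 \<le> i" "j \<in> B i k" for i j k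
    using S that by (auto simp: realizes_def)
  have finish: "finish I S j = t_finish J (T i k) j + delay Q \<epsilon> k (t_type (T i k) (t_assign (T i k) j))"
    if "1 \<le> i" "j \<in> B i k" for i j k
    using job[OF that] hosted(1)[OF that(1) tent_job(3)[OF that]] by (simp add: finish_def t_finish_def)
  have in_machines: "H i k m \<in> machines S" if "1 \<le> i" "m \<in> Mach i k" for i k m
    using host_in_hosting[OF that] by (simp add: machines)
  have batch: "\<exists>k. j \<in> B (phase j) k" if jI: "j \<in> jobs I" for j
  proof -
    obtain k where "j \<in> class_jobs Q \<epsilon> J k"
      using class_exists[OF jI] .
    then show ?thesis
      using batch_iff[OF phase_ge, of j j k] by auto
  qed
  show "finite (machines S)"
    using finite_idx finite_early machines by simp
  show "0 \<le> open_at S M" if M: "M \<in> machines S" for M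
  proof (cases M)
    case (Batch i k m)
    then show ?thesis
      using open_eq[OF M] D_pos by (simp add: phase_end_def)
  next
    case (Early j)
    have "j \<in> jobs I"
    proof (cases "M \<in> hosting ` idx")
      case True
      then obtain i k m where "1 \<le> i" "m \<in> Mach i k" "M = H i k m"
        by (auto simp: idx_def hosting_def)
      then show ?thesis
        using early_props(2)[of i m k] batch_jobs Early by (auto simp: host_def split: if_splits)
    next
      case False
      then show ?thesis
        using M machines Early class_jobs_subset[of Q \<epsilon> J J21]
        by (auto simp: early_machines_def split: if_splits)
    qed
    then show ?thesis
      using open_eq[OF M] Early release_nonneg by simp
  qed
  show "open_at S M + s (mach_type S M) \<le> close_at S M" if M: "M \<in> machines S" for M
  proof (cases "M \<in> hosting ` idx")
    case True
    then obtain i k m where u: "1 \<le> i" "m \<in> Mach i k" "M = H i k m"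
      by (auto simp: idx_def hosting_def)
    obtain j where "j \<in> B i k" "t_assign (T i k) j = m"
      using u(2) by (auto simp: t_machines_def)
    then have "begins i k m \<le> ends i k m"
      using t_from_le[OF finite_batch] t_to_ge[OF finite_batch, of j i k "T i k" m J] finish_ge
      by (meson order_trans)
    then show ?thesis
      using open_le_from[OF u(1,2)] hosted[OF u(1,2)] open_eq[OF M] u(3) by simp
  next
    case False
    then have "mach_type S M = TypeA" "close_at S M = open_at S M + s TypeA"
      using S M machines by (auto simp: realizes_def used_eq)
    then show ?thesis
      by simp
  qed
  fix j assume j: "j \<in> jobs I"
  obtain k where k: "j \<in> B (phase j) k"
    using batch[OF j] by blast
  note jk = phase_ge[of j] k
  let ?m = "t_assign (T (phase j) k) j"
  let ?M = "H (phase j) k ?m"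
  note m = tent_job(3)[OF jk]
  show "assigned S j \<in> machines S"
    using job(1)[OF jk] in_machines[OF _ m] phase_ge by simp
  show "release I j \<le> start S j"
    using tent_job(1)[OF jk] job(2)[OF jk] delay_bounds(1)[of k "t_type (T (phase j) k) ?m"] by simp
  show "finish I S j \<le> deadline I j"
    using tent_job(2)[OF jk] finish[OF jk] delay_bounds(2)[of k "t_type (T (phase j) k) ?m"] by simp
  show "open_at S (assigned S j) + s (mach_type S (assigned S j)) \<le> start S j"
    using open_le_from[OF jk(1) m] hosted(1)[OF jk(1) m] open_eq[OF in_machines[OF jk(1) m]]
      t_from_le[OF finite_batch k refl, of "T (phase j) k"] job[OF jk] by simp
  show "finish I S j \<le> close_at S (assigned S j)"
    using t_to_ge[OF finite_batch k refl, of J "T (phase j) k"] finish[OF jk] hosted(2)[OF jk(1) m]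
      job[OF jk] by simp
  fix l assume l: "l \<in> jobs I" and jl: "j \<noteq> l \<and> assigned S j = assigned S l"
  obtain k' where k': "l \<in> B (phase l) k'"
    using batch[OF l] by blast
  note lk = phase_ge[of l] k'
  \<comment> \<open>Sharing a machine means sharing the tentative machine, as hosting is
    injective.\<close>
  have same: "phase j = phase l \<and> k = k' \<and> ?m = t_assign (T (phase l) k') l"
    by (rule host_inj[OF jk(1) lk(1) m tent_job(3)[OF lk]]) (use jl job(1)[OF jk] job(1)[OF lk] in simp)
  then have "t_finish J (T (phase j) k) j \<le> t_start (T (phase j) k) l \<or>
      t_finish J (T (phase j) k) l \<le> t_start (T (phase j) k) j"
    using admissible[OF jk(1), of k] k k' jl unfolding t_admissible_def t_feasible_def by metis
  then show "finish I S j \<le> start S l \<or> finish I S l \<le> start S j"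
    using same finish[OF jk] finish[OF lk] job(2)[OF jk] job(2)[OF lk] by auto
qed

section \<open>Cost of the realization\<close>

lemma idx_eq:
  assumes "\<And>j. j \<in> jobs I \<Longrightarrow> phase j \<le> n"
  shows "idx = Sigma {1..n} (\<lambda>i. Sigma UNIV (\<lambda>k. Mach i k))"
proof -
  have "i \<le> n" if i: "1 \<le> i" and m: "m \<in> Mach i k" for i k m
  proof -
    obtain j where "j \<in> B i k"
      using m by (auto simp: t_machines_def)
    then show ?thesis
      using assms[of j] batch_jobs[of j i k] batch_iff[OF i] by simp
  qed
  then show ?thesis
    by (auto simp: idx_def)
qed

text \<open>Hosting a tentative machine at most doubles its cost by \<open>rental_le\<close>. The
  other machines are idle early ones, at most one per job of \<open>J21\<close>, each paying only
  for its setup at rate 1.\<close>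

lemma cost_realization:
  assumes S: "realizes Q \<epsilon> J T g S" and n: "\<And>j. j \<in> jobs I \<Longrightarrow> phase j \<le> n"
  shows "cost Q S \<le> 2 * (\<Sum>i=1..n. \<Sum>k\<in>UNIV. t_cost Q J (B i k) (T i k))
    + (if condC Q \<epsilon> then 0 else real (card (J21_jobs Q \<epsilon> J)) * s TypeA)"
proof -
  let ?f = "\<lambda>M. rate Q (mach_type S M) * (close_at S M - open_at S M)"
  let ?h = "\<lambda>(i, k, m). 2 * (rate Q (t_type (T i k) m) * (s (t_type (T i k) m) + ends i k m - begins i k m))"
  let ?E = "early_machines Q \<epsilon> J - hosting ` idx"
  have fin: "finite (Mach i k)" for i k
    using finite_batch by (simp add: t_machines_def)
  have machines: "machines S = hosting ` idx \<union> ?E"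
    using S by (auto simp: realizes_def used_eq)
  then have "cost Q S = sum ?f (hosting ` idx) + sum ?f ?E"
    unfolding cost_def machines using finite_idx finite_early by (intro sum.union_disjoint) auto
  moreover have "sum ?f (hosting ` idx) \<le> sum ?h idx"
    unfolding sum.reindex[OF inj_hosting] o_def
  proof (rule sum_mono)
    fix u assume "u \<in> idx"
    then obtain i k m where u: "u = (i, k, m)" "1 \<le> i" "m \<in> Mach i k"
      by (auto simp: idx_def)
    have "H i k m \<in> hosting ` idx"
      using host_in_hosting u by blast
    then have M: "H i k m \<in> machines S" "mach_type S (H i k m) = t_type (T i k) m"
      "close_at S (H i k m) = ends i k m + delay Q \<epsilon> k (t_type (T i k) m)"
      using S u by (auto simp: realizes_def used_eq)
    then have "open_at S (H i k m) = opening_time Q \<epsilon> J (H i k m)"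
      using S by (simp add: realizes_def)
    then have "close_at S (H i k m) - open_at S (H i k m) \<le> 2 * (s (t_type (T i k) m) + ends i k m - begins i k m)"
      using rental_le[OF u(2,3)] M by simp
    then have "rate Q (t_type (T i k) m) * (close_at S (H i k m) - open_at S (H i k m))
        \<le> rate Q (t_type (T i k) m) * (2 * (s (t_type (T i k) m) + ends i k m - begins i k m))"
      using rate_ge[of "t_type (T i k) m"] by (intro mult_left_mono) auto
    then show "?f (hosting u) \<le> ?h u"
      using M by (simp add: hosting_def u(1) algebra_simps)
  qed
  moreover have "sum ?h idx = 2 * (\<Sum>i=1..n. \<Sum>k\<in>UNIV. t_cost Q J (B i k) (T i k))"
  proof -
    have idx: "idx = Sigma {1..n} (\<lambda>i. Sigma UNIV (\<lambda>k. Mach i k))"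
      using idx_eq n by blast
    have "(\<Sum>i=1..n. \<Sum>p\<in>Sigma UNIV (Mach i). ?h (i, p)) = sum ?h idx"
      using fin by (subst sum.Sigma) (auto simp: split_def idx)
    moreover have "(\<Sum>k\<in>UNIV. \<Sum>m\<in>Mach i k. ?h (i, k, m)) = (\<Sum>p\<in>Sigma UNIV (Mach i). ?h (i, p))" for i
      using fin by (subst sum.Sigma) (auto simp: split_def)
    ultimately show ?thesis
      by (simp add: t_cost_def sum_distrib_left)
  qed
  moreover have "sum ?f ?E \<le> (if condC Q \<epsilon> then 0 else real (card (J21_jobs Q \<epsilon> J)) * s TypeA)"
  proof -
    have fJ: "finite (J21_jobs Q \<epsilon> J)"
      using class_jobs_subset[of Q \<epsilon> J J21] finite_jobs by (auto intro: finite_subset)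
    have "sum ?f ?E = (\<Sum>M\<in>?E. s TypeA)"
      using S by (intro sum.cong) (auto simp: realizes_def used_eq rate_A)
    also have "\<dots> \<le> (\<Sum>M\<in>early_machines Q \<epsilon> J. s TypeA)"
      using finite_early setup_pos[of TypeA] by (intro sum_mono2) auto
    also have "\<dots> \<le> (if condC Q \<epsilon> then 0 else real (card (J21_jobs Q \<epsilon> J)) * s TypeA)"
      using setup_pos[of TypeA] card_image_le[OF fJ, of Early] by (simp add: early_machines_def)
    finally show ?thesis .
  qed
  ultimately show ?thesis
    by linarith
qed

end

section \<open>Existence of an output\<close>

context dispatch
begin

lemma batched_dispatch_runs: "batched_dispatch Q \<epsilon> I S \<longleftrightarrow>
    (\<exists>T g. dispatch_run Q \<epsilon> I T g \<and> realizes Q \<epsilon> J T g S)"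
  unfolding batched_dispatch_def dispatch_run_def dispatch_run_axioms_def
  using dispatch_axioms by blast

lemma output_exists: "\<exists>S. batched_dispatch Q \<epsilon> I S"
proof -
  have "\<exists>T. \<forall>i k. 1 \<le> i \<longrightarrow> tentative Q \<epsilon> J i k (T i k)"
    using tentative_schedule_exists by metis
  then obtain T where T: "\<And>i k. 1 \<le> i \<Longrightarrow> tentative Q \<epsilon> J i k (T i k)"
    by blast
  have "\<exists>g. early_choice Q \<epsilon> J i (T i J21) g" if i: "1 \<le> i" for i
  proof -
    let ?X = "B i J21" and ?T = "T i J21"
    have "\<forall>m\<in>t_machines ?X ?T. \<exists>j. j \<in> ?X \<and> t_assign ?T j = m \<and> t_start ?T j = t_from ?X ?T m"
      using t_from_attained[OF finite_batch] by metis
    \<comment> \<open>The early machine opened for the first job on \<open>m\<close> is given to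
      \<open>m\<close>: that job is released by its start, and different machines have different
      first jobs.\<close>
    then obtain g where g: "\<And>m. m \<in> t_machines ?X ?T \<Longrightarrow>
        g m \<in> ?X \<and> t_assign ?T (g m) = m \<and> t_start ?T (g m) = t_from ?X ?T m"
      by metis
    have "release I j \<le> t_start ?T j" if "j \<in> ?X" for j
      using T[OF i, of J21] that by (auto simp: tentative_def t_admissible_def t_feasible_def)
    then have "early_choice Q \<epsilon> J i ?T g"
      using g unfolding early_choice_def Let_def inj_on_def by (auto; metis)
    then show ?thesis
      by blast
  qed
  then obtain g where g: "\<And>i. 1 \<le> i \<Longrightarrow> early_choice Q \<epsilon> J i (T i J21) (g i)"
    by metis
  interpret dispatch_run Q \<epsilon> I T g
    using T g by unfold_locales auto
  show ?thesis
    using realization_exists dispatch_run_axioms batched_dispatch_runs by blast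
qed

end

section \<open>Comparison with an arbitrary schedule\<close>

locale comparison = dispatch +
  fixes R :: "'m schedule"
  assumes R: "feasible Q I R"
begin

section \<open>Lower bounds on the cost of the schedule \<open>R\<close>\<close>

definition ty :: "nat \<Rightarrow> mtype" where
  "ty j = mach_type R (assigned R j)"

definition len :: "nat \<Rightarrow> real" where
  "len j = psize I j (ty j)"

lemma len_pos: "j \<in> jobs I \<Longrightarrow> 0 < len j"
  using psize_ge[of j "ty j"] by (simp add: len_def)

text \<open>The jobs on \<open>M\<close> are disjoint and run after its setup, so the rental period
  contains the setup time plus their total length.\<close>

lemma machine_cost_ge:
  assumes M: "M \<in> machines R"
  shows "rate Q (mach_type R M) * s (mach_type R M) + (\<Sum>j\<in>{j\<in>jobs I. assigned R j = M}. rate Q (ty j) * len j)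
    \<le> rate Q (mach_type R M) * (close_at R M - open_at R M)"
proof -
  let ?X = "{j\<in>jobs I. assigned R j = M}"
  have "sum len ?X \<le> close_at R M - (open_at R M + s (mach_type R M))"
  proof (rule sum_lengths_le[where st = "start R"])
    show "open_at R M + s (mach_type R M) \<le> close_at R M"
      using R M by (simp add: feasible_def)
  qed (use R len_pos finite_jobs in \<open>auto simp: feasible_def finish_def len_def ty_def\<close>)
  then have "rate Q (mach_type R M) * (s (mach_type R M) + sum len ?X)
      \<le> rate Q (mach_type R M) * (close_at R M - open_at R M)"
    using rate_ge[of "mach_type R M"] by (intro mult_left_mono) auto
  moreover have "rate Q (mach_type R M) * sum len ?X = (\<Sum>j\<in>?X. rate Q (ty j) * len j)"
    unfolding sum_distrib_left by (intro sum.cong) (auto simp: ty_def)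
  ultimately show ?thesis
    by (simp add: distrib_left)
qed

lemma rate_len_nonneg: "j \<in> jobs I \<Longrightarrow> 0 \<le> rate Q (ty j) * len j"
  using rate_ge[of "ty j"] len_pos[of j] by simp

lemma cost_ge:
  "(\<Sum>M\<in>machines R. rate Q (mach_type R M) * s (mach_type R M)) + (\<Sum>j\<in>jobs I. rate Q (ty j) * len j) \<le> cost Q R"
proof -
  have "(\<Sum>j\<in>jobs I. rate Q (ty j) * len j)
      = (\<Sum>M\<in>machines R. \<Sum>j\<in>{j\<in>jobs I. assigned R j = M}. rate Q (ty j) * len j)"
    using R finite_jobs by (intro sum.group[symmetric]) (auto simp: feasible_def)
  then show ?thesis
    unfolding cost_def using sum_mono[OF machine_cost_ge] by (simp add: sum.distrib)
qed

lemma rate_setup_nonneg: "0 \<le> rate Q \<tau> * s \<tau>"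
  using rate_ge[of \<tau>] setup_pos[of \<tau>] by simp

lemma cost_ge_lengths: "(\<Sum>j\<in>jobs I. rate Q (ty j) * len j) \<le> cost Q R"
  using cost_ge sum_nonneg[of "machines R" "\<lambda>M. rate Q (mach_type R M) * s (mach_type R M)"]
    rate_setup_nonneg by simp

lemma sum_len_le: "sum len (jobs I) \<le> cost Q R"
proof -
  have "sum len (jobs I) \<le> (\<Sum>j\<in>jobs I. rate Q (ty j) * len j)"
    using rate_ge len_pos by (intro sum_mono) (simp add: less_imp_le)
  then show ?thesis
    using cost_ge_lengths by linarith
qed

lemma len_le_cost: "j \<in> jobs I \<Longrightarrow> len j \<le> cost Q R"
  using member_le_sum[of j "jobs I" len] finite_jobs len_pos sum_len_le by (fastforce intro: less_imp_le)

lemma cost_nonneg: "0 \<le> cost Q R"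
  using sum_len_le sum_nonneg[of "jobs I" len] len_pos by (fastforce intro: less_imp_le)

lemma setup_le_cost:
  assumes "j \<in> jobs I"
  shows "rate Q (ty j) * s (ty j) \<le> cost Q R"
proof -
  have "rate Q (ty j) * s (ty j) \<le> (\<Sum>M\<in>machines R. rate Q (mach_type R M) * s (mach_type R M))"
    unfolding ty_def using R assms rate_setup_nonneg
    by (intro member_le_sum[where f = "\<lambda>M. rate Q (mach_type R M) * s (mach_type R M)"])
      (auto simp: feasible_def)
  then show ?thesis
    using cost_ge sum_nonneg[of "jobs I" "\<lambda>j. rate Q (ty j) * len j"] rate_len_nonneg by simp
qed

text \<open>\<open>R\<close> has at least one machine, and either type has a setup time of at least
  \<open>s TypeA\<close> and a rate of at least 1.\<close>

lemma setup_A_le_cost: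
  assumes "j \<in> jobs I"
  shows "s TypeA \<le> cost Q R"
proof -
  have "s TypeA \<le> 1 * s (ty j)"
    using setup_le[of TypeA] by (cases "ty j") auto
  also have "\<dots> \<le> rate Q (ty j) * s (ty j)"
    using rate_ge[of "ty j"] setup_pos[of "ty j"] by (intro mult_right_mono) auto
  finally show ?thesis
    using setup_le_cost[OF assms] by linarith
qed

lemma setup_B_le_cost: "j \<in> jobs I \<Longrightarrow> ty j = TypeB \<Longrightarrow> c * s TypeB \<le> cost Q R"
  using setup_le_cost[of j] by simp

section \<open>Upper bounds on the costs of tentative schedules\<close>

lemma tentative_le_pack:
  assumes i: "1 \<le> i" and T: "tentative Q \<epsilon> J i k T"
    and allowed: "\<And>j. j \<in> B i k \<Longrightarrow> \<tau> j \<in> allowed_types k"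
    and finish: "\<And>j. j \<in> B i k \<Longrightarrow> t_finish J (pack J (B i k) \<tau> D (P i)) j \<le> deadline J j"
    and len: "\<And>j. j \<in> B i k \<Longrightarrow> psize I j (\<tau> j) \<le> len j"
  shows "t_cost Q J (B i k) T \<le> c * (2 / \<epsilon> + 1) * sum len (B i k) + (\<Sum>\<upsilon>\<in>\<tau> ` B i k. rate Q \<upsilon> * s \<upsilon>)"
proof -
  interpret pk: packing J "B i k" \<tau> D "P i"
    by (rule packing_batch)
  let ?X = "B i k"
  let ?p = "\<lambda>j. psize I j (\<tau> j)"
  let ?L = "\<lambda>\<upsilon>. \<Sum>j\<in>{j\<in>?X. \<tau> j = \<upsilon>}. ?p j"
  have c1: "1 \<le> c"
    by (rule rate_ge)
  have "t_cost Q J ?X T \<le> t_cost Q J ?X pk.T"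
    using T pack_admissible[OF allowed finish] by (simp add: tentative_def)
  also have "\<dots> \<le> (\<Sum>\<upsilon>\<in>\<tau> ` ?X. rate Q \<upsilon> * s \<upsilon> * (?L \<upsilon> / D + 1)) + (\<Sum>j\<in>?X. rate Q (\<tau> j) * ?p j)"
  proof -
    have "0 \<le> rate Q \<upsilon>" "0 \<le> s \<upsilon>" for \<upsilon>
      using rate_ge[of \<upsilon>] setup_pos[of \<upsilon>] by linarith+
    then show ?thesis
      using pk.pack_cost[of Q] by simp
  qed
  \<comment> \<open>Up to rounding there is one setup per \<open>D\<close> units of work, and
    \<open>c * s TypeB\<close> is \<open>c * (2 / \<epsilon>) * D\<close>; rounding leaves one setup
    per type in use.\<close>
  also have "(\<Sum>\<upsilon>\<in>\<tau> ` ?X. rate Q \<upsilon> * s \<upsilon> * (?L \<upsilon> / D + 1))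
      \<le> (\<Sum>\<upsilon>\<in>\<tau> ` ?X. c * (2 / \<epsilon>) * ?L \<upsilon> + rate Q \<upsilon> * s \<upsilon>)"
  proof (rule sum_mono)
    fix \<upsilon>
    have L: "0 \<le> ?L \<upsilon> / D"
      using pk.size_nonneg D_pos by (intro divide_nonneg_pos sum_nonneg) auto
    have "rate Q \<upsilon> * s \<upsilon> \<le> c * s TypeB"
      using rate_le[of \<upsilon>] setup_le[of \<upsilon>] rate_ge[of \<upsilon>] setup_pos[of \<upsilon>] by (intro mult_mono) auto
    then have "rate Q \<upsilon> * s \<upsilon> * (?L \<upsilon> / D) \<le> c * s TypeB * (?L \<upsilon> / D)"
      using L by (rule mult_right_mono)
    also have "\<dots> = c * (2 / \<epsilon>) * ?L \<upsilon>"
      using setup_B D_pos by simp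
    finally show "rate Q \<upsilon> * s \<upsilon> * (?L \<upsilon> / D + 1) \<le> c * (2 / \<epsilon>) * ?L \<upsilon> + rate Q \<upsilon> * s \<upsilon>"
      by (simp add: distrib_left)
  qed
  also have "(\<Sum>\<upsilon>\<in>\<tau> ` ?X. c * (2 / \<epsilon>) * ?L \<upsilon> + rate Q \<upsilon> * s \<upsilon>)
      = c * (2 / \<epsilon>) * sum ?p ?X + (\<Sum>\<upsilon>\<in>\<tau> ` ?X. rate Q \<upsilon> * s \<upsilon>)"
  proof -
    have "(\<Sum>\<upsilon>\<in>\<tau> ` ?X. ?L \<upsilon>) = sum ?p ?X"
      using finite_batch by (intro sum.group) auto
    then show ?thesis
      by (simp only: sum.distrib sum_distrib_left[symmetric])
  qed
  also have "(\<Sum>j\<in>?X. rate Q (\<tau> j) * ?p j) \<le> c * sum ?p ?X"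
    unfolding sum_distrib_left using pk.size_nonneg rate_le by (intro sum_mono mult_right_mono) auto
  finally have "t_cost Q J ?X T \<le> c * (2 / \<epsilon> + 1) * sum ?p ?X + (\<Sum>\<upsilon>\<in>\<tau> ` ?X. rate Q \<upsilon> * s \<upsilon>)"
    by (simp add: algebra_simps)
  also have "c * (2 / \<epsilon> + 1) * sum ?p ?X \<le> c * (2 / \<epsilon> + 1) * sum len ?X"
    using c1 eps len by (intro mult_left_mono sum_mono) auto
  finally show ?thesis
    by simp
qed

lemma tentative_le_expensive:
  assumes i: "1 \<le> i" and T: "tentative Q \<epsilon> J i k T"
  shows "t_cost Q J (B i k) T \<le> c * (2 / \<epsilon> + 1) * sum len (B i k) + 2 * (c * s TypeB)"
proof -
  \<comment> \<open>The type used in \<open>R\<close> is kept wherever the class allows it and the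
    slack there is at least \<open>2 * D\<close>.\<close>
  define \<tau> where "\<tau> j = (if k = J3 \<or> (k = J1 \<and> ty j = TypeA \<and> 2 * D \<le> slack J j TypeA) then TypeA else TypeB)" for j
  have slack: "2 * D \<le> slack J j (\<tau> j)" if "j \<in> B i k" for j
    using slack_B[OF that] slack_J3 that by (auto simp: \<tau>_def)
  \<comment> \<open>A job changes its type only towards more slack, that is, towards a smaller size,
    so the packed work is at most the work of \<open>R\<close>.\<close>
  have other: "slack J j (ty j) < 2 * D" if "j \<in> B i k" "\<tau> j \<noteq> ty j" for j
    using that slack_J3[of j i] slack_J2(1)[of j i k] slack_B[of j i k]
    by (cases k; cases "ty j") (auto simp: \<tau>_def split: if_splits)
  have "t_cost Q J (B i k) T \<le> c * (2 / \<epsilon> + 1) * sum len (B i k) + (\<Sum>\<upsilon>\<in>\<tau> ` B i k. rate Q \<upsilon> * s \<upsilon>)"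
  proof (rule tentative_le_pack[OF i T])
    fix j assume j: "j \<in> B i k"
    show "\<tau> j \<in> allowed_types k"
      by (cases k) (auto simp: \<tau>_def)
    show "t_finish J (pack J (B i k) \<tau> D (P i)) j \<le> deadline J j"
      using pack_finish_le[where \<tau> = \<tau>, OF i j slack[OF j]] .
    show "psize I j (\<tau> j) \<le> len j"
      using slack[OF j] other[OF j] by (cases "\<tau> j = ty j") (auto simp: len_def slack_def)
  qed
  also have "(\<Sum>\<upsilon>\<in>\<tau> ` B i k. rate Q \<upsilon> * s \<upsilon>) \<le> (\<Sum>\<upsilon>\<in>UNIV. rate Q \<upsilon> * s \<upsilon>)"
    using rate_setup_nonneg by (intro sum_mono2) auto
  also have "\<dots> \<le> 2 * (c * s TypeB)"
  proof -
    have "rate Q TypeA * s TypeA \<le> c * s TypeB"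
      using rate_le setup_le rate_ge[of TypeA] rate_ge[of TypeB] setup_pos[of TypeA] by (intro mult_mono) auto
    then show ?thesis
      by (simp add: UNIV_mtype)
  qed
  finally show ?thesis
    by simp
qed

text \<open>A schedule of cost below \<open>D\<close> that uses no machine of type B leaves so little work that one
  machine of type A per batch suffices, even for the jobs whose slack on type A is below \<open>2 * D\<close>.\<close>

lemma tentative_le_cheap:
  assumes i: "1 \<le> i" and T: "tentative Q \<epsilon> J i k T"
    and cheap: "cost Q R < D" "cost Q R < c * s TypeB"
  shows "t_cost Q J (B i k) T \<le> c * (2 / \<epsilon> + 1) * sum len (B i k) + s TypeA"
proof -
  have tyA: "ty j = TypeA" if "j \<in> jobs I" for j
    using setup_B_le_cost[OF that] cheap by (cases "ty j") auto
  have lenA: "psize I j TypeA = len j" if "j \<in> B i k" for j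
    using tyA[OF batch_jobs[OF that]] by (simp add: len_def)
  \<comment> \<open>Jobs of \<open>J2\<close> are longer than \<open>D\<close> on type A, hence too
    long for \<open>R\<close>.\<close>
  have no_J2: "k \<noteq> J21 \<and> k \<noteq> J22" if "j \<in> B i k" for j
    using slack_J2(2)[OF that] len_le_cost[OF batch_jobs[OF that]] lenA[OF that] cheap by auto
  let ?\<tau> = "\<lambda>_. TypeA"
  interpret pk: packing J "B i k" ?\<tau> D "P i"
    by (rule packing_batch)
  have sum_D: "sum len (B i k) < D"
  proof -
    have "sum len (B i k) \<le> sum len (jobs I)"
      using finite_jobs batch_jobs len_pos by (intro sum_mono2) (auto intro: less_imp_le)
    then show ?thesis
      using sum_len_le cheap by linarith
  qed
  have "t_cost Q J (B i k) T \<le> c * (2 / \<epsilon> + 1) * sum len (B i k) + (\<Sum>\<upsilon>\<in>?\<tau> ` B i k. rate Q \<upsilon> * s \<upsilon>)"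
  proof (rule tentative_le_pack[OF i T])
    fix j assume j: "j \<in> B i k"
    show "TypeA \<in> allowed_types k"
      using no_J2[OF j] by (cases k) auto
    show "psize I j TypeA \<le> len j"
      using lenA[OF j] by simp
    show "t_finish J pk.T j \<le> deadline J j"
    proof (cases "2 * D \<le> slack J j TypeA")
      case True
      then show ?thesis
        by (rule pack_finish_le[OF i j])
    next
      case False
      \<comment> \<open>The slack on type B puts the deadline at least \<open>2 * D\<close> after
        the release, hence at least \<open>D\<close> after the phase end; all the work of the batch
        fits in between.\<close>
      then have "2 * D \<le> slack J j TypeB"
        using slack_tighten[OF batch_jobs[OF j]] by blast
      then have "2 * D + release I j \<le> deadline J j"
        using psize_ge[OF batch_jobs[OF j], of TypeB] by (simp add: slack_def)
      moreover have "P i - D \<le> release I j"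
        using j P_diff[OF i] by (simp add: batch_def)
      moreover have "load J (B i k) ?\<tau> j + psize J j TypeA < D"
        using pk.load_add_size_le_sum[OF j] sum_D lenA by simp
      ultimately show ?thesis
        using pk.pack_start_le_load[of j] by (simp add: pk.pack_finish)
    qed
  qed
  also have "(\<Sum>\<upsilon>\<in>?\<tau> ` B i k. rate Q \<upsilon> * s \<upsilon>) \<le> s TypeA"
    using setup_pos[of TypeA] by (cases "B i k = {}") (auto simp: rate_A image_constant_conv)
  finally show ?thesis
    by simp
qed

text \<open>\<open>E\<close> is the setup cost per batch that is not charged to work:
  \<open>s TypeA\<close> if \<open>R\<close> is cheap, else \<open>c * s TypeB\<close>. Over all
  phases, the bound \<open>c * s TypeB\<close> is paid by the standing assumption, except for one
  phase, which the bound in terms of \<open>cost Q R\<close> pays. If \<open>R\<close> is not cheap,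
  the latter holds since \<open>c * s TypeB\<close> is \<open>2 / \<epsilon> * c * D\<close>, or is
  itself at most \<open>cost Q R\<close>.\<close>

lemma tentative_le:
  assumes "jobs I \<noteq> {}"
  obtains E where "0 \<le> E" "E \<le> 2 / \<epsilon> * c * cost Q R" "E \<le> c * s TypeB"
    "\<And>i k T. 1 \<le> i \<Longrightarrow> tentative Q \<epsilon> J i k T \<Longrightarrow>
      t_cost Q J (B i k) T \<le> c * (2 / \<epsilon> + 1) * sum len (B i k) + 2 * E"
proof (cases "cost Q R < D \<and> cost Q R < c * s TypeB")
  case True
  have c1: "1 \<le> c"
    by (rule rate_ge)
  have "s TypeA \<le> 1 * cost Q R"
    using setup_A_le_cost assms by auto
  also have "\<dots> \<le> 2 / \<epsilon> * c * cost Q R"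
  proof (rule mult_right_mono)
    have "1 * 1 \<le> 2 / \<epsilon> * c"
      using c1 eps by (intro mult_mono) auto
    then show "1 \<le> 2 / \<epsilon> * c"
      by simp
  qed (rule cost_nonneg)
  finally have "s TypeA \<le> 2 / \<epsilon> * c * cost Q R" .
  moreover have "1 * s TypeA \<le> c * s TypeB"
    using c1 setup_le[of TypeA] setup_pos[of TypeA] by (intro mult_mono) auto
  ultimately show ?thesis
    using that[of "s TypeA"] tentative_le_cheap True setup_pos[of TypeA] by fastforce
next
  case False
  have c1: "1 \<le> c"
    by (rule rate_ge)
  have e: "1 \<le> 2 / \<epsilon>"
    using eps by simp
  have "c * s TypeB \<le> 2 / \<epsilon> * c * cost Q R"
  proof (cases "D \<le> cost Q R")
    case True
    then have "2 / \<epsilon> * c * D \<le> 2 / \<epsilon> * c * cost Q R"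
      using c1 eps by (intro mult_left_mono) auto
    then show ?thesis
      unfolding setup_B by (simp add: algebra_simps)
  next
    case le: False
    have "1 * 1 \<le> 2 / \<epsilon> * c"
      using c1 e eps by (intro mult_mono) auto
    then have "1 * cost Q R \<le> 2 / \<epsilon> * c * cost Q R"
      using cost_nonneg by (intro mult_right_mono) auto
    then show ?thesis
      using False le by linarith
  qed
  then show ?thesis
    using that[of "c * s TypeB"] tentative_le_expensive rate_setup_nonneg by blast
qed

section \<open>Adding up the phases\<close>

lemma sum_batches_le: "(\<Sum>i=1..n. \<Sum>k\<in>UNIV. sum len (B i k)) \<le> sum len (jobs I)"
proof -
  have "(\<Sum>i=1..n. \<Sum>k\<in>UNIV. sum len (B i k)) = (\<Sum>(i, k)\<in>{1..n} \<times> UNIV. sum len (B i k))"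
    by (rule sum.cartesian_product)
  also have "\<dots> = (\<Sum>u\<in>{1..n} \<times> UNIV. sum len (case_prod B u))"
    by (simp add: split_def)
  also have "\<dots> = sum len (\<Union>u\<in>{1..n} \<times> UNIV. case_prod B u)"
  proof (rule sum.UNION_disjoint[symmetric])
    show "\<forall>u\<in>{1..n} \<times> UNIV. \<forall>v\<in>{1..n} \<times> UNIV. u \<noteq> v \<longrightarrow> case_prod B u \<inter> case_prod B v = {}"
      using class_jobs_unique by (auto simp: batch_iff)
  qed (auto simp: finite_batch)
  also have "\<dots> \<le> sum len (jobs I)"
    using finite_jobs batch_jobs len_pos by (intro sum_mono2) (auto intro: less_imp_le)
  finally show ?thesis .
qed

text \<open>Each job of \<open>J21\<close> pays for its early machine. If \<open>R\<close> runs it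
  on type A, its length exceeds \<open>D\<close>, and \<open>2 / \<epsilon> * D\<close> is
  \<open>s TypeB\<close>; if on type B, processing it costs more than \<open>s TypeA\<close> by the
  definition of \<open>J21\<close> without \<open>condC\<close>.\<close>

lemma early_cost_le:
  assumes "\<not> condC Q \<epsilon>"
  shows "real (card (J21_jobs Q \<epsilon> J)) * s TypeA \<le> 2 / \<epsilon> * cost Q R"
proof -
  have e: "1 \<le> 2 / \<epsilon>"
    using eps by simp
  have sub: "J21_jobs Q \<epsilon> J \<subseteq> jobs I"
    using class_jobs_subset[of Q \<epsilon> J J21] by simp
  have "real (card (J21_jobs Q \<epsilon> J)) * s TypeA = (\<Sum>j\<in>J21_jobs Q \<epsilon> J. s TypeA)"
    by simp
  also have "\<dots> \<le> (\<Sum>j\<in>J21_jobs Q \<epsilon> J. 2 / \<epsilon> * (rate Q (ty j) * len j))"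
  proof (rule sum_mono)
    fix j assume j: "j \<in> J21_jobs Q \<epsilon> J"
    show "s TypeA \<le> 2 / \<epsilon> * (rate Q (ty j) * len j)"
    proof (cases "ty j")
      case TypeA
      then have "D \<le> len j"
        using j assms by (auto simp: J21_jobs_def J2_jobs_def len_def)
      then have "2 / \<epsilon> * D \<le> 2 / \<epsilon> * len j"
        using eps by (intro mult_left_mono) auto
      then show ?thesis
        using setup_le[of TypeA] setup_B TypeA by (simp add: rate_A)
    next
      case TypeB
      then have "s TypeA \<le> 1 * (rate Q (ty j) * len j)"
        using j assms by (auto simp: J21_jobs_def len_def)
      also have "\<dots> \<le> 2 / \<epsilon> * (rate Q (ty j) * len j)"
        using e rate_len_nonneg sub j by (intro mult_right_mono) auto
      finally show ?thesis .
    qed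
  qed
  also have "\<dots> = 2 / \<epsilon> * (\<Sum>j\<in>J21_jobs Q \<epsilon> J. rate Q (ty j) * len j)"
    by (simp add: sum_distrib_left)
  also have "\<dots> \<le> 2 / \<epsilon> * (\<Sum>j\<in>jobs I. rate Q (ty j) * len j)"
    using eps sub finite_jobs rate_len_nonneg by (intro mult_left_mono sum_mono2) auto
  also have "\<dots> \<le> 2 / \<epsilon> * cost Q R"
    using eps cost_ge_lengths by (intro mult_left_mono) auto
  finally show ?thesis .
qed

lemma r_max_nonneg: "0 \<le> r_max I"
  unfolding r_max_def using finite_jobs by (intro Max_ge) auto

lemma phase_le:
  assumes "j \<in> jobs I"
  shows "phase j \<le> nat \<lfloor>r_max I / D\<rfloor> + 1"
proof -
  have "release I j \<le> r_max I"
    unfolding r_max_def using assms finite_jobs by (intro Max_ge) auto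
  then show ?thesis
    unfolding phase_def using D_pos by (intro add_right_mono nat_mono floor_mono divide_right_mono) auto
qed

text \<open>With \<open>?W = c / \<epsilon> * cost Q R\<close>, the tentative costs are at most
  \<open>3 * ?W + 8 * (n * E)\<close>, where \<open>2 / \<epsilon> + 1 \<le> 3 / \<epsilon>\<close>
  gives the 3. Realization doubles this, idle early machines add \<open>2 * ?W\<close>, and
  \<open>n * E \<le> (2 / \<kappa> + 2) * ?W\<close> gives the constant.\<close>

lemma output_cost_le:
  assumes S: "batched_dispatch Q \<epsilon> I S"
    and \<kappa>: "0 < \<kappa>" "\<kappa> * (c * r_max I) \<le> cost Q R"
  shows "cost Q S \<le> (40 + 32 / \<kappa>) * (c / \<epsilon>) * cost Q R"
proof -
  obtain T g where run: "dispatch_run Q \<epsilon> I T g" and real: "realizes Q \<epsilon> J T g S"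
    using S batched_dispatch_runs by blast
  interpret run: dispatch_run Q \<epsilon> I T g
    by (rule run)
  have c1: "1 \<le> c"
    by (rule rate_ge)
  have ce: "0 \<le> c / \<epsilon>"
    using c1 eps by simp
  have K: "0 \<le> 40 + 32 / \<kappa>"
    using \<kappa>(1) by simp
  show ?thesis
  \<comment> \<open>Without jobs \<open>R\<close> may have no machine to which \<open>E\<close>
    could be charged.\<close>
  proof (cases "jobs I = {}")
    case True
    then have "J21_jobs Q \<epsilon> J = {}"
      using class_jobs_subset[of Q \<epsilon> J J21] by simp
    then have "cost Q S \<le> 0"
      using run.cost_realization[OF real, of 0] True by (simp split: if_splits)
    also have "0 \<le> (40 + 32 / \<kappa>) * (c / \<epsilon>) * cost Q R"
      by (intro mult_nonneg_nonneg K ce cost_nonneg)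
    finally show ?thesis .
  next
    case False
    obtain E where E: "0 \<le> E" "E \<le> 2 / \<epsilon> * c * cost Q R" "E \<le> c * s TypeB"
      and tent: "\<And>i k T. 1 \<le> i \<Longrightarrow> tentative Q \<epsilon> J i k T \<Longrightarrow>
        t_cost Q J (B i k) T \<le> c * (2 / \<epsilon> + 1) * sum len (B i k) + 2 * E"
      using tentative_le[OF False] by blast
    define n where "n = nat \<lfloor>r_max I / D\<rfloor> + 1"
    let ?W = "c / \<epsilon> * cost Q R"
    have "1 * cost Q R / \<epsilon> \<le> c * cost Q R / \<epsilon>"
      using c1 cost_nonneg eps by (intro divide_right_mono mult_right_mono) auto
    then have W: "1 / \<epsilon> * cost Q R \<le> ?W"
      by simp
    \<comment> \<open>Of the at most \<open>r_max I / D + 1\<close> phases, the first summand uses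
      \<open>E \<le> c * s TypeB\<close> and the assumption on \<open>r_max I\<close>, the
      \<open>1\<close> uses the bound of \<open>E\<close> by \<open>2 * ?W\<close>.\<close>
    have nE: "real n * E \<le> (2 / \<kappa> + 2) * ?W"
    proof -
      have "real n \<le> r_max I / D + 1"
        using r_max_nonneg D_pos by (simp add: n_def)
      then have "real n * E \<le> (r_max I / D + 1) * E"
        using E(1) by (rule mult_right_mono)
      also have "\<dots> = r_max I / D * E + E"
        by (simp add: distrib_right)
      also have "r_max I / D * E \<le> r_max I / D * (c * s TypeB)"
        using r_max_nonneg D_pos E(3) by (intro mult_left_mono) auto
      also have "\<dots> = 2 / \<epsilon> * (c * r_max I)"
        using D_pos by (simp add: setup_B)
      also have "\<dots> \<le> 2 / \<epsilon> * (cost Q R / \<kappa>)"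
        using \<kappa> eps by (intro mult_left_mono) (auto simp: field_simps)
      also have "\<dots> = 2 / \<kappa> * (1 / \<epsilon> * cost Q R)"
        by simp
      also have "\<dots> \<le> 2 / \<kappa> * ?W"
        using W \<kappa>(1) by (intro mult_left_mono) auto
      finally have "real n * E \<le> 2 / \<kappa> * ?W + E"
        by simp
      moreover have "E \<le> 2 * ?W"
        using E(2) by simp
      ultimately show ?thesis
        unfolding distrib_right by linarith
    qed
    have "(\<Sum>i=1..n. \<Sum>k\<in>UNIV. t_cost Q J (B i k) (T i k))
        \<le> (\<Sum>i=1..n. \<Sum>k\<in>UNIV. c * (2 / \<epsilon> + 1) * sum len (B i k) + 2 * E)"
      using tent run.tentative by (intro sum_mono) auto
    also have "\<dots> = c * (2 / \<epsilon> + 1) * (\<Sum>i=1..n. \<Sum>k\<in>UNIV. sum len (B i k)) + 8 * (real n * E)"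
    proof -
      \<comment> \<open>Four classes with \<open>2 * E\<close> each give
        \<open>8 * E\<close>.\<close>
      have "(\<Sum>k\<in>UNIV. c * (2 / \<epsilon> + 1) * sum len (B i k) + 2 * E)
          = c * (2 / \<epsilon> + 1) * (\<Sum>k\<in>UNIV. sum len (B i k)) + 8 * E" for i
        by (simp add: UNIV_jclass distrib_left)
      then show ?thesis
        by (simp add: sum.distrib sum_distrib_left[symmetric])
    qed
    also have "c * (2 / \<epsilon> + 1) * (\<Sum>i=1..n. \<Sum>k\<in>UNIV. sum len (B i k)) \<le> c * (3 / \<epsilon>) * cost Q R"
    proof (rule mult_mono)
      show "c * (2 / \<epsilon> + 1) \<le> c * (3 / \<epsilon>)"
        using c1 eps by (intro mult_left_mono) (auto simp: field_simps)
      show "(\<Sum>i=1..n. \<Sum>k\<in>UNIV. sum len (B i k)) \<le> cost Q R"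
        using sum_batches_le sum_len_le by (rule order_trans)
      show "0 \<le> (\<Sum>i=1..n. \<Sum>k\<in>UNIV. sum len (B i k))"
        using len_pos batch_jobs by (intro sum_nonneg) (blast intro: less_imp_le)
    qed (use c1 eps in simp)
    finally have tents: "(\<Sum>i=1..n. \<Sum>k\<in>UNIV. t_cost Q J (B i k) (T i k)) \<le> 3 * ?W + 8 * (real n * E)"
      by (simp add: mult.left_commute mult.commute)
    have "(if condC Q \<epsilon> then 0 else real (card (J21_jobs Q \<epsilon> J)) * s TypeA) \<le> 2 / \<epsilon> * cost Q R"
      using early_cost_le cost_nonneg eps by auto
    then have "(if condC Q \<epsilon> then 0 else real (card (J21_jobs Q \<epsilon> J)) * s TypeA) \<le> 2 * ?W"
      using W by simp
    then have "cost Q S \<le> 2 * (3 * ?W + 8 * (real n * E)) + 2 * ?W"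
      using run.cost_realization[OF real, of n] phase_le tents by (simp add: n_def)
    also have "\<dots> \<le> 2 * (3 * ?W + 8 * ((2 / \<kappa> + 2) * ?W)) + 2 * ?W"
      using nE by simp
    also have "\<dots> = (40 + 32 / \<kappa>) * ?W"
    proof -
      have "2 * (3 * w + 8 * ((2 / \<kappa> + 2) * w)) + 2 * w = (40 + 32 / \<kappa>) * w" for w
        by (simp add: distrib_right)
      then show ?thesis .
    qed
    also have "\<dots> = (40 + 32 / \<kappa>) * (c / \<epsilon>) * cost Q R"
      by (simp only: mult.assoc)
    finally show ?thesis .
  qed
qed

end

section \<open>Passing to the optimum\<close>

context dispatch
begin

text \<open>\<open>Opt\<close> is an infimum of reals, meaningful only over a nonempty set. Every
  job gets its own machine, opened at its release, of a type on which its slack covers the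
  setup.\<close>

lemma feasible_exists: "\<exists>R :: nat schedule. feasible Q I R"
proof -
  define \<tau> where "\<tau> j = (if slack I j TypeA \<ge> s TypeB then TypeA else TypeB)" for j
  have slack: "s (\<tau> j) \<le> slack I j (\<tau> j)" if "j \<in> jobs I" for j
  proof -
    have "s TypeB \<le> (1 + \<epsilon>) * s TypeB"
      using eps setup_pos[of TypeB] by (simp add: algebra_simps)
    moreover have "(1 + \<epsilon>) * s TypeB \<le> slack I j TypeA \<or> (1 + \<epsilon>) * s TypeB \<le> slack I j TypeB"
      using that slack_ge by (auto simp: min_slack_def le_max_iff_disj)
    ultimately show ?thesis
      using setup_le[of TypeA] by (auto simp: \<tau>_def)
  qed
  let ?R = "\<lparr>machines = jobs I, mach_type = \<tau>, open_at = release I,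
    close_at = \<lambda>j. release I j + s (\<tau> j) + psize I j (\<tau> j), assigned = id,
    start = \<lambda>j. release I j + s (\<tau> j)\<rparr>"
  have "feasible Q I ?R"
    unfolding feasible_def finish_def
    using finite_jobs release_nonneg setup_pos psize_ge slack
    by (auto simp: slack_def less_imp_le algebra_simps intro: order_trans[OF zero_le_one])
  then show ?thesis
    by blast
qed

lemma competitive_ratio:
  assumes S: "batched_dispatch Q \<epsilon> I S" and \<kappa>: "0 < \<kappa>" "\<kappa> * (c * r_max I) \<le> Opt Q I"
  shows "cost Q S \<le> (40 + 32 / \<kappa>) * (c / \<epsilon> + 1 / \<epsilon> ^ 3) * Opt Q I"
proof -
  let ?X = "{cost Q R | R :: nat schedule. feasible Q I R}"
  let ?\<rho> = "(40 + 32 / \<kappa>) * (c / \<epsilon>)"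
  have \<rho>: "0 < ?\<rho>"
    using \<kappa>(1) eps rate_ge[of TypeB] by (intro mult_pos_pos add_pos_pos divide_pos_pos) auto
  have ne: "?X \<noteq> {}"
    using feasible_exists by blast
  have nonneg: "0 \<le> x" if "x \<in> ?X" for x
  proof -
    obtain R :: "nat schedule" where xR: "x = cost Q R" "feasible Q I R"
      using \<open>x \<in> ?X\<close> by blast
    interpret comparison Q \<epsilon> I R
      using xR by unfold_locales
    show ?thesis
      using cost_nonneg xR by simp
  qed
  have bdd: "bdd_below ?X"
    using nonneg by (intro bdd_belowI)
  \<comment> \<open>Dividing by the ratio turns the bounds for all feasible \<open>R\<close> into a
    lower bound of the set, which passes to the infimum without an optimal schedule.\<close>
  have "cost Q S / ?\<rho> \<le> x" if "x \<in> ?X" for x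
  proof -
    obtain R :: "nat schedule" where xR: "x = cost Q R" "feasible Q I R"
      using \<open>x \<in> ?X\<close> by blast
    interpret comparison Q \<epsilon> I R
      using xR by unfold_locales
    \<comment> \<open>This transfers the standing assumption from \<open>Opt\<close> to the cost of
      \<open>R\<close>.\<close>
    have "Opt Q I \<le> cost Q R"
      unfolding Opt_def using bdd R by (intro cInf_lower) auto
    then have "cost Q S \<le> ?\<rho> * cost Q R"
      using output_cost_le[OF S \<kappa>(1)] \<kappa>(2) by linarith
    then show ?thesis
      unfolding xR(1) pos_divide_le_eq[OF \<rho>] by (metis mult.commute)
  qed
  then have "cost Q S / ?\<rho> \<le> Opt Q I"
    unfolding Opt_def using ne by (intro cInf_greatest) auto
  then have "cost Q S \<le> ?\<rho> * Opt Q I"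
    unfolding pos_divide_le_eq[OF \<rho>] by (metis mult.commute)
  also have "\<dots> \<le> (40 + 32 / \<kappa>) * (c / \<epsilon> + 1 / \<epsilon> ^ 3) * Opt Q I"
  proof (rule mult_right_mono)
    show "0 \<le> Opt Q I"
      unfolding Opt_def using ne nonneg by (intro cInf_greatest) auto
    show "?\<rho> \<le> (40 + 32 / \<kappa>) * (c / \<epsilon> + 1 / \<epsilon> ^ 3)"
      using \<kappa>(1) eps by (intro mult_left_mono) auto
  qed
  finally show ?thesis .
qed

end

theorem theorem1:
  fixes \<kappa> :: real
  assumes "\<kappa> > 0"
  shows "\<exists>K>0. \<forall>Q \<epsilon>. normalized_cloud Q \<and> 1 / setup_time Q TypeB \<le> \<epsilon> \<and> \<epsilon> \<le> 1 \<longrightarrow>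
           competitive Q \<kappa> (batched_dispatch Q \<epsilon>) ((1 + \<epsilon>) * setup_time Q TypeB)
             (K * (rate Q TypeB / \<epsilon> + 1 / \<epsilon> ^ 3))"
proof (intro exI conjI allI impI)
  \<comment> \<open>The constant depends on \<open>\<kappa>\<close> only, not on \<open>Q\<close> or
    \<open>\<epsilon>\<close>.\<close>
  show "0 < 40 + 32 / \<kappa>"
    using assms by (simp add: add_pos_pos)
  fix Q \<epsilon> assume Q: "normalized_cloud Q \<and> 1 / setup_time Q TypeB \<le> \<epsilon> \<and> \<epsilon> \<le> 1"
  have "0 < 1 / setup_time Q TypeB"
    using Q by (auto simp: normalized_cloud_def)
  then have \<epsilon>: "0 < \<epsilon>"
    using Q by linarith
  show "competitive Q \<kappa> (batched_dispatch Q \<epsilon>) ((1 + \<epsilon>) * setup_time Q TypeB)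
      ((40 + 32 / \<kappa>) * (rate Q TypeB / \<epsilon> + 1 / \<epsilon> ^ 3))"
    unfolding competitive_def
  proof (intro allI impI)
    fix I assume I: "valid_inst I \<and> min_slack ((1 + \<epsilon>) * setup_time Q TypeB) I \<and>
      \<kappa> * (rate Q TypeB * r_max I) \<le> Opt Q I"
    interpret dispatch Q \<epsilon> I
      using Q \<epsilon> I by unfold_locales auto
    have "feasible Q I S" if "batched_dispatch Q \<epsilon> I S" for S
      using that batched_dispatch_runs dispatch_run.feasible_realization by blast
    then show "(\<exists>S. batched_dispatch Q \<epsilon> I S) \<and> (\<forall>S. batched_dispatch Q \<epsilon> I S \<longrightarrow>
        feasible Q I S \<and> cost Q S \<le> (40 + 32 / \<kappa>) * (rate Q TypeB / \<epsilon> + 1 / \<epsilon> ^ 3) * Opt Q I)"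
      using output_exists competitive_ratio assms I by blast
  qed
qed

end
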